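(* Let $p>1$, $0<\alpha<1/2$ and $0<\sigma<2$. (i) If $p\ge \frac{2\sigma}{2-\sigma}$, then there is a constant $C=C(p,\alpha,\sigma)$ such that for every real $n\ge 2$ and every function $f\in H^p$ which is mean $n$-valent in $\mathbb{D}$, $$\|f\|^\sigma_{B_\sigma^\alpha} \le C\, n^{\alpha\sigma} (\log n)^{\sigma/2}\,\|f\|^\sigma_{H^p}.$$ (ii) If $p< \frac{2\sigma}{2-\sigma}$ and $\sigma < \frac{p}{\alpha p+1}$, then there is a constant $C=C(p,\alpha,\sigma)$ such that for every real $n>0$ and every function $f\in H^p$ which is mean $n$-valent in $\mathbb{D}$, $$\|f\|^\sigma_{B_\sigma^\alpha} \le C\, n^{\alpha\sigma +\sigma/p +\sigma/2-1}\, \|f\|^\sigma_{H^p}.$$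
   Context: $\mathbb{D}$ is the open unit disc in $\mathbb{C}$, $\mathcal{A}$ is the area (planar Lebesgue) measure, and $H^p$ is the standard Hardy space in $\mathbb{D}$ with norm $\|\cdot\|_{H^p}$. For $f$ analytic in $\mathbb{D}$ the Besov seminorm is given by $$\|f\|^\sigma_{B_\sigma^\alpha} = \int_{\mathbb{D}} |f'(z)|^\sigma (1-|z|^2)^{(1-\alpha)\sigma -1}\, \mathrm{d}\mathcal{A}(z).$$ For a function $f$ analytic in a domain $G\subset\mathbb{C}$ and $w\in\mathbb{C}$, let $n(w)$ be the number of solutions of the equation $f(z)=w$ in $G$, counting multiplicities. For a positive real number $n$ (not necessarily an integer), $f$ is called mean $n$-valent in $G$ if for every $R>0$ $$\frac{1}{\pi}\int_0^R\int_0^{2\pi} n(re^{it})\,\mathrm{d}t\, r\,\mathrm{d}r \le nR^2.$$ *)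

theory Defs
  imports "HOL-Complex_Analysis.Complex_Analysis"
begin

definition hardy_mean :: "real \<Rightarrow> real \<Rightarrow> (complex \<Rightarrow> complex) \<Rightarrow> real" where
  "hardy_mean p r f =
     (1 / (2 * pi) * integral {0..2 * pi} (\<lambda>t. norm (f (of_real r * cis t)) powr p)) powr (1 / p)"

definition hardy_space :: "real \<Rightarrow> (complex \<Rightarrow> complex) set" where
  "hardy_space p =
     {f. f holomorphic_on ball 0 1 \<and> bdd_above ((\<lambda>r. hardy_mean p r f) ` {0..<1})}"

text \<open>The supremum is taken in the reals, so it is meaningful only for members of
  \<^const>\<open>hardy_space\<close>.\<close>

definition hardy_norm :: "real \<Rightarrow> (complex \<Rightarrow> complex) \<Rightarrow> real" where
  "hardy_norm p f = (SUP r\<in>{0..<1}. hardy_mean p r f)"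

text \<open>The \<open>\<sigma>\<close>-th power of the Besov seminorm. It takes values in \<^typ>\<open>ennreal\<close>, so a finite
  upper bound on it includes the convergence of the integral.\<close>

definition besov_seminorm_powr :: "real \<Rightarrow> real \<Rightarrow> (complex \<Rightarrow> complex) \<Rightarrow> ennreal" where
  "besov_seminorm_powr \<alpha> \<sigma> f =
     (\<integral>\<^sup>+ z \<in> ball 0 1.
        ennreal (norm (deriv f z) powr \<sigma> * (1 - (norm z)\<^sup>2) powr ((1 - \<alpha>) * \<sigma> - 1)) \<partial>lborel)"

text \<open>On a domain, infinitely many solutions occur either for a non-constant \<open>f\<close> or for
  \<open>f\<close> constantly equal to \<open>w\<close>; in the latter case \<^const>\<open>zorder\<close> would be unspecified, but
  it is not consulted. In the finite case it is the usual multiplicity.\<close>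

definition num_solutions :: "(complex \<Rightarrow> complex) \<Rightarrow> complex set \<Rightarrow> complex \<Rightarrow> ennreal" where
  "num_solutions f G w =
     (if finite {z \<in> G. f z = w}
      then of_nat (\<Sum>z | z \<in> G \<and> f z = w. nat (zorder (\<lambda>u. f u - w) z))
      else \<infinity>)"

definition mean_valent :: "real \<Rightarrow> (complex \<Rightarrow> complex) \<Rightarrow> complex set \<Rightarrow> bool" where
  "mean_valent n f G \<longleftrightarrow> f holomorphic_on G \<and>
     (\<forall>R>0. ennreal (1 / pi) *
         (\<integral>\<^sup>+ r \<in> {0..R}.
            (\<integral>\<^sup>+ t \<in> {0..2 * pi}. num_solutions f G (of_real r * cis t) \<partial>lborel) * ennreal r
          \<partial>lborel)
       \<le> ennreal (n * R\<^sup>2))"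

end

theory Submission
  imports Defs
begin

text \<open>
  Cut the disc into the dyadic annuli on which \<open>1 - |z|\<close> is comparable to \<open>d = (1 / 2) ^ k\<close>, and
  normalise the Hardy norm to 1. Membership in the Hardy space alone bounds the integral of
  \<open>|f'| powr p\<close> over such an annulus by \<open>C * d powr (1 - p)\<close>, hence its contribution to the seminorm by
  \<open>C * d powr (- \<alpha> * \<sigma>)\<close>; this is good enough for \<open>d \<ge> 1 / n\<close>.

  Closer to the boundary, Hoelder's inequality bounds the integral of \<open>|f'| powr \<sigma>\<close> by powers of the integrals of
  \<open>|f'|\<^sup>2 * max 1 |f| powr (- q)\<close> and of \<open>max 1 |f| powr (q * \<sigma> / (2 - \<sigma>))\<close>. The second integral is of
  order \<open>d\<close> if \<open>q * \<sigma> / (2 - \<sigma>) \<le> p\<close>. The first one is controlled by mean valency, since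
  the integral of \<open>|f'|\<^sup>2\<close> over the set where \<open>|f| < R\<close> is at most \<open>pi * n * R\<^sup>2\<close>, while
  \<open>|f| \<le> C * d powr (- 1 / p)\<close> on the annulus. The levels \<open>R = C * 2 powr (j / p)\<close>, \<open>j \<le> k\<close>, contribute
  a sum that is linear in \<open>k\<close> for \<open>q = 2\<close>, whence the logarithm in part (i), and geometric for
  \<open>q = p * (2 - \<sigma>) / \<sigma> < 2\<close>, which gives part (ii).
\<close>

section \<open>Area of injective holomorphic images\<close>

text \<open>The cut at d = 1 / n is where the two bounds for an annulus meet: the Hardy bound is d
  powr (- \<alpha> * \<sigma>), and the area bound for q = 2 is the same quantity times (n * d) powr
  (\<sigma> / 2), up to a power of the logarithm. Towards the boundary the area bound is summable
  because \<alpha> < 1 / 2 in part (i), and because \<sigma> < p / (\<alpha> * p + 1) in part (ii).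
  The q of part (ii) is the largest that Hardy membership can pay for. Being less than 2, it leaves
  a surplus at d = 1 / n, which is the excess of the exponent of n over \<alpha> * \<sigma>.

  Mean valency speaks of iterated polar integrals of a counting function, whereas the estimates need
  area integrals of |f'|^2. An inequality suffices for the passage: the noncritical points are cut
  into countably many Borel pieces on which f is injective, and the areas of their images add up to
  at most the integral of the counting function. The same area formula for injective maps, applied
  to the exponential function, yields polar coordinates.\<close>

definition vec_of_complex :: "complex \<Rightarrow> real^2" where
  "vec_of_complex z = vector [Re z, Im z]"

definition complex_of_vec :: "real^2 \<Rightarrow> complex" where
  "complex_of_vec v = Complex (v $ 1) (v $ 2)"

lemma vec_of_complex_nth [simp]:
  "vec_of_complex z $ 1 = Re z" "vec_of_complex z $ 2 = Im z"
  by (simp_all add: vec_of_complex_def)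

lemma complex_of_vec_inverse [simp]: "vec_of_complex (complex_of_vec v) = v"
  by (simp add: complex_of_vec_def vec_eq_iff forall_2)

lemma vec_of_complex_inverse [simp]: "complex_of_vec (vec_of_complex z) = z"
  by (simp add: complex_of_vec_def)

lemma linear_vec_of_complex: "linear vec_of_complex"
  by (rule linearI) (simp_all add: vec_eq_iff forall_2)

lemma linear_complex_of_vec: "linear complex_of_vec"
  by (rule linearI) (simp_all add: complex_of_vec_def complex_eq_iff)

lemma bounded_linear_vec_of_complex: "bounded_linear vec_of_complex"
  using linear_vec_of_complex by (simp add: linear_conv_bounded_linear)

lemma bounded_linear_complex_of_vec: "bounded_linear complex_of_vec"
  using linear_complex_of_vec by (simp add: linear_conv_bounded_linear)

lemma borel_measurable_complex_of_vec [measurable]: "complex_of_vec \<in> borel \<rightarrow>\<^sub>M borel"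
  by (intro borel_measurable_continuous_onI linear_continuous_on bounded_linear_complex_of_vec)

text \<open>Carries Lebesgue measure to \<open>real^2\<close>, where a Jacobian is a matrix
  determinant. Open boxes determine the measure, and the coordinate map sends boxes to
  boxes.\<close>

lemma lborel_complex_eq_distr_vec: "lborel = distr lborel borel complex_of_vec"
proof (rule lborel_eqI)
  fix l u :: complex
  assume le: "\<And>b. b \<in> Basis \<Longrightarrow> l \<bullet> b \<le> u \<bullet> b"
  have vim: "complex_of_vec -` box l u = box (vec_of_complex l) (vec_of_complex u)"
    by (auto simp: box_def complex_of_vec_def Basis_complex_def mem_box_cart Basis_vec_def
          inner_axis forall_2 UNIV_2)
  have le': "Re l \<le> Re u" "Im l \<le> Im u"
    using le[of 1] le[of \<i>] by (auto simp: Basis_complex_def)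
  have "emeasure (distr lborel borel complex_of_vec) (box l u)
      = emeasure lborel (box (vec_of_complex l) (vec_of_complex u))"
    by (simp add: emeasure_distr vim)
  also have "\<dots> = (\<Prod>b\<in>Basis. (vec_of_complex u - vec_of_complex l) \<bullet> b)"
    using le' by (intro emeasure_lborel_box) (auto simp: Basis_vec_def inner_axis UNIV_2)
  also have "(\<Prod>b\<in>Basis. (vec_of_complex u - vec_of_complex l) \<bullet> b) = (\<Prod>b\<in>Basis. (u - l) \<bullet> b)"
  proof -
    have Basis2: "(Basis :: (real^2) set) = {axis 1 1, axis 2 1}"
      by (auto simp: Basis_vec_def UNIV_2)
    have "axis (1::2) (1::real) \<noteq> axis 2 1"
      by (simp add: axis_eq_axis)
    then have "(\<Prod>b\<in>Basis. x \<bullet> b) = x $ 1 * x $ 2" for x :: "real^2"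
      unfolding Basis2 by (simp add: inner_axis)
    then show ?thesis
      by (simp add: Basis_complex_def)
  qed
  finally show "emeasure (distr lborel borel complex_of_vec) (box l u) = (\<Prod>b\<in>Basis. (u - l) \<bullet> b)" .
qed simp

text \<open>Multiplication by c is a rotation scaled by |c|. With c = \<open>deriv f z\<close> this
  is the real Jacobian of a holomorphic map, by the Cauchy-Riemann equations.\<close>

lemma det_matrix_complex_mult:
  "det (matrix (\<lambda>v. vec_of_complex (c * complex_of_vec v))) = (norm c)\<^sup>2"
proof -
  have "(norm c)\<^sup>2 = Re c * Re c + Im c * Im c"
    using cmod_power2[of c] by (simp add: power2_eq_square)
  then show ?thesis
    by (simp add: det_2 matrix_def complex_of_vec_def axis_def)
qed

lemma nn_integral_complex_of_vec:
  assumes [measurable]: "g \<in> borel_measurable borel"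
  shows "(\<integral>\<^sup>+ v. g (complex_of_vec v) \<partial>lborel) = (\<integral>\<^sup>+ z. g z \<partial>lborel)"
  by (subst lborel_complex_eq_distr_vec, subst nn_integral_distr) simp_all

lemma emeasure_vec_of_complex_image:
  assumes [measurable]: "A \<in> sets borel"
  shows "vec_of_complex ` A \<in> sets borel" "emeasure lborel (vec_of_complex ` A) = emeasure lborel A"
proof -
  have eq: "vec_of_complex ` A = complex_of_vec -` A"
    by (auto simp: image_iff) (metis complex_of_vec_inverse)
  have "complex_of_vec -` A \<inter> space borel \<in> sets borel"
    by measurable
  then show "vec_of_complex ` A \<in> sets borel"
    by (simp add: eq)
  show "emeasure lborel (vec_of_complex ` A) = emeasure lborel A"
    by (subst lborel_complex_eq_distr_vec) (simp add: emeasure_distr eq)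
qed

text \<open>The image is a preimage under the holomorphic inverse, which is defined on the open
  image of \<open>U\<close>.\<close>

lemma borel_image_holomorphic_inj:
  assumes f: "f holomorphic_on U" "open U" "inj_on f U" and A: "A \<in> sets borel" "A \<subseteq> U"
  shows "f ` A \<in> sets borel"
proof -
  obtain g where g: "g holomorphic_on f ` U" "\<And>z. z \<in> U \<Longrightarrow> g (f z) = z"
    using holomorphic_has_inverse[OF f] by metis
  have "f ` A = {w \<in> f ` U. g w \<in> A}"
    using A(2) g(2) by (auto simp: subset_iff)
  moreover have "open (f ` U)"
    using open_mapping_thm3[OF f] .
  moreover have "g \<in> borel_measurable (restrict_space borel (f ` U))"
    by (intro borel_measurable_continuous_on_restrict holomorphic_on_imp_continuous_on g)
  ultimately show ?thesis
    using A(1) by (auto simp: measurable_def space_restrict_space sets_restrict_space_iff vimage_def Int_def conj_commute)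
qed

text \<open>The change of variables theorem is an equivalence between finite area of the image and
  integrability of the Jacobian. One direction gives the formula when the integral is finite; the
  other shows that the area is infinite when the integral is.\<close>

lemma emeasure_holomorphic_inj_image:
  assumes f: "f holomorphic_on U" "open U" "inj_on f U" and A: "A \<in> sets borel" "A \<subseteq> U"
  shows "emeasure lborel (f ` A) = (\<integral>\<^sup>+ z. ennreal ((norm (deriv f z))\<^sup>2) * indicator A z \<partial>lborel)"
proof -
  note [measurable] = A(1)
  define F where "F v = vec_of_complex (f (complex_of_vec v))" for v
  define S where "S = vec_of_complex ` A"
  define D where "D v = (\<lambda>x. vec_of_complex (deriv f (complex_of_vec v) * complex_of_vec x))" for v
  have fA: "f ` A \<in> sets borel"
    using borel_image_holomorphic_inj[OF f A] .
  have S: "S \<in> sets borel"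
    unfolding S_def using A(1) by (rule emeasure_vec_of_complex_image)
  have FS: "F ` S = vec_of_complex ` (f ` A)"
    by (auto simp: F_def S_def image_iff)
  have der: "(F has_derivative D v) (at v within S)" if "v \<in> S" for v
  proof -
    have "complex_of_vec v \<in> U"
      using that A(2) by (auto simp: S_def)
    then have "(f has_field_derivative deriv f (complex_of_vec v)) (at (complex_of_vec v))"
      using f by (simp add: holomorphic_derivI)
    then have "((\<lambda>v. f (complex_of_vec v)) has_derivative (\<lambda>x. deriv f (complex_of_vec v) * complex_of_vec x)) (at v)"
      unfolding has_field_derivative_def
      by (rule has_derivative_compose[OF bounded_linear_imp_has_derivative[OF bounded_linear_complex_of_vec]])
    then have "(F has_derivative D v) (at v)"
      unfolding F_def D_def by (rule bounded_linear.has_derivative[OF bounded_linear_vec_of_complex])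
    then show ?thesis
      by (rule has_derivative_at_withinI)
  qed
  have inj: "inj_on F S"
    using f(3) A(2) unfolding F_def S_def inj_on_def by (auto simp: subset_iff) (metis vec_of_complex_inverse)
  have det: "\<bar>det (matrix (D v))\<bar> = (norm (deriv f (complex_of_vec v)))\<^sup>2" for v
    by (simp add: D_def det_matrix_complex_mult)
  have iff: "F ` S \<in> lmeasurable \<and> measure lebesgue (F ` S) = m
     \<longleftrightarrow> ((\<lambda>v. (norm (deriv f (complex_of_vec v)))\<^sup>2) has_integral m) S" for m
    using has_measure_differentiable_image[OF _ der inj, of m] S by (simp add: det)
  have FSb: "F ` S \<in> sets borel" and FSm: "emeasure lborel (F ` S) = emeasure lborel (f ` A)"
    unfolding FS using fA by (auto intro: emeasure_vec_of_complex_image)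
  \<comment> \<open>Nothing is known about \<open>deriv f\<close> off \<open>U\<close>, so
    measurability is shown for its extension by zero and then read off on \<open>A\<close>.\<close>
  have "continuous_on U (deriv f)"
    using f by (intro holomorphic_on_imp_continuous_on holomorphic_deriv)
  then have "(\<lambda>z. indicator U z *\<^sub>R deriv f z) \<in> borel_measurable borel"
    using f(2) by (intro borel_measurable_continuous_on_indicator) auto
  then have dm: "(\<lambda>z. (norm (indicator U z *\<^sub>R deriv f z))\<^sup>2 * indicator A z) \<in> borel_measurable borel"
    by measurable
  have "(\<lambda>z. (norm (indicator U z *\<^sub>R deriv f z))\<^sup>2 * indicator A z) = (\<lambda>z. (norm (deriv f z))\<^sup>2 * indicator A z :: real)"
    using A(2) by (auto simp: indicator_def fun_eq_iff)
  with dm have dm: "(\<lambda>z. (norm (deriv f z))\<^sup>2 * indicator A z :: real) \<in> borel_measurable borel"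
    by simp
  define I where "I = (\<integral>\<^sup>+ z. ennreal ((norm (deriv f z))\<^sup>2 * indicator A z) \<partial>lborel)"
  have indS: "indicator S v = (indicator A (complex_of_vec v) :: real)" for v
  proof -
    have "v \<in> S \<longleftrightarrow> complex_of_vec v \<in> A"
      using image_eqI[of v vec_of_complex "complex_of_vec v" A] by (auto simp: S_def)
    then show ?thesis
      by (simp add: indicator_def)
  qed
  have I_vec: "I = (\<integral>\<^sup>+ v. ennreal ((norm (deriv f (complex_of_vec v)))\<^sup>2 * indicator S v) \<partial>lborel)"
    unfolding I_def indS using dm by (subst nn_integral_complex_of_vec[symmetric]) auto
  have "emeasure lborel (f ` A) = I"
  proof (cases "I < \<infinity>")
    case True
    then obtain m where m: "I = ennreal m" "m \<ge> 0"
      by (metis ennreal_cases infinity_ennreal_def order_less_irrefl)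
    have "((\<lambda>v. (norm (deriv f (complex_of_vec v)))\<^sup>2 * indicator S v) has_integral m) UNIV"
    proof (rule nn_integral_has_integral)
      show "(\<lambda>v. (norm (deriv f (complex_of_vec v)))\<^sup>2 * indicator S v) \<in> borel_measurable borel"
        unfolding indS using measurable_compose[OF borel_measurable_complex_of_vec dm] by simp
      show "(\<integral>\<^sup>+ v. ennreal ((norm (deriv f (complex_of_vec v)))\<^sup>2 * indicator S v) \<partial>lborel) = ennreal m"
        using I_vec m by simp
    qed (use m in auto)
    moreover have "(\<lambda>v. (norm (deriv f (complex_of_vec v)))\<^sup>2 * indicator S v)
        = (\<lambda>v. if v \<in> S then (norm (deriv f (complex_of_vec v)))\<^sup>2 else 0)"
      by (auto simp: fun_eq_iff indicator_def)
    ultimately have "((\<lambda>v. (norm (deriv f (complex_of_vec v)))\<^sup>2) has_integral m) S"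
      by (simp add: has_integral_restrict_UNIV)
    then have "F ` S \<in> lmeasurable" "measure lebesgue (F ` S) = m"
      using iff by blast+
    then have "emeasure lebesgue (F ` S) = ennreal m"
      by (simp add: emeasure_eq_measure2)
    then show ?thesis
      using FSb FSm m by simp
  next
    case False
    have "\<not> emeasure lborel (f ` A) < \<infinity>"
    proof
      assume "emeasure lborel (f ` A) < \<infinity>"
      then have "F ` S \<in> lmeasurable"
        using FSb FSm by (intro fmeasurableI) auto
      then have "((\<lambda>v. (norm (deriv f (complex_of_vec v)))\<^sup>2) has_integral measure lebesgue (F ` S)) S"
        using iff by blast
      from nn_integral_has_integral_lebesgue'[OF _ this]
      have "(\<integral>\<^sup>+ v. ennreal ((norm (deriv f (complex_of_vec v)))\<^sup>2) * indicator S v \<partial>lborel) < \<infinity>"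
        by simp
      moreover have "I = (\<integral>\<^sup>+ v. ennreal ((norm (deriv f (complex_of_vec v)))\<^sup>2) * indicator S v \<partial>lborel)"
        unfolding I_vec by (intro nn_integral_cong) (auto simp: indicator_def)
      ultimately show False
        using False by simp
    qed
    with False show ?thesis
      by (simp add: less_top[symmetric])
  qed
  also have "I = (\<integral>\<^sup>+ z. ennreal ((norm (deriv f z))\<^sup>2) * indicator A z \<partial>lborel)"
    unfolding I_def by (intro nn_integral_cong) (auto simp: indicator_def)
  finally show ?thesis .
qed

section \<open>Polar coordinates\<close>

lemma borel_measurable_Complex [measurable]:
  "(\<lambda>(x, y). Complex x y) \<in> borel \<Otimes>\<^sub>M borel \<rightarrow>\<^sub>M borel"
  unfolding borel_prod case_prod_unfold Complex_eq
  by (intro borel_measurable_continuous_onI continuous_intros)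

lemma lborel_complex_eq_distr_pair:
  "(lborel :: complex measure) = distr (lborel \<Otimes>\<^sub>M lborel) borel (\<lambda>(x, y). Complex x y)"
proof (rule lborel_eqI)
  fix l u :: complex
  assume le: "\<And>b. b \<in> Basis \<Longrightarrow> l \<bullet> b \<le> u \<bullet> b"
  have le': "Re l \<le> Re u" "Im l \<le> Im u"
    using le[of 1] le[of \<i>] by (auto simp: Basis_complex_def)
  have vim: "(\<lambda>(x, y). Complex x y) -` box l u = {Re l<..<Re u} \<times> {Im l<..<Im u}"
    by (auto simp: box_def Basis_complex_def)
  show "emeasure (distr (lborel \<Otimes>\<^sub>M lborel) borel (\<lambda>(x, y). Complex x y)) (box l u)
      = (\<Prod>b\<in>Basis. (u - l) \<bullet> b)"
    using le'
    by (subst emeasure_distr)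
      (simp_all add: space_pair_measure vim lborel.emeasure_pair_measure_Times Basis_complex_def ennreal_mult)
qed simp

lemma nn_integral_complex_pair:
  assumes [measurable]: "g \<in> borel_measurable borel"
  shows "(\<integral>\<^sup>+ z. g z \<partial>lborel) = (\<integral>\<^sup>+ x. (\<integral>\<^sup>+ y. g (Complex x y) \<partial>lborel) \<partial>lborel)"
  by (subst lborel_complex_eq_distr_pair, subst nn_integral_distr)
    (simp_all add: lborel.nn_integral_fst[symmetric])

text \<open>Substitution on the compact interval [-n, n], then monotone convergence on both sides,
  since the intervals [exp (-n), exp n] exhaust the positive half-line.\<close>

lemma nn_integral_exp_substitution:
  fixes f :: "real \<Rightarrow> ennreal"
  assumes [measurable]: "f \<in> borel_measurable borel"
  shows "(\<integral>\<^sup>+ x. f (exp x) * ennreal (exp x) \<partial>lborel) = (\<integral>\<^sup>+ r. f r * indicator {0<..} r \<partial>lborel)"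
proof -
  have "(\<integral>\<^sup>+ x. f (exp x) * ennreal (exp x) \<partial>lborel)
      = (\<integral>\<^sup>+ x. (SUP n. f (exp x) * ennreal (exp x) * indicator {- real n..real n} x) \<partial>lborel)"
  proof (intro nn_integral_cong)
    fix x :: real
    obtain n where n: "\<bar>x\<bar> \<le> real n"
      using real_arch_simple by blast
    show "f (exp x) * ennreal (exp x) = (SUP n. f (exp x) * ennreal (exp x) * indicator {- real n..real n} x)"
    proof (rule antisym)
      show "f (exp x) * ennreal (exp x) \<le> (SUP n. f (exp x) * ennreal (exp x) * indicator {- real n..real n} x)"
        by (rule SUP_upper2[of n]) (use n in \<open>auto simp: indicator_def\<close>)
    qed (auto intro!: SUP_least simp: indicator_def)
  qed
  also have "\<dots> = (SUP n. \<integral>\<^sup>+ x. f (exp x) * ennreal (exp x) * indicator {- real n..real n} x \<partial>lborel)"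
    by (intro nn_integral_monotone_convergence_SUP) (auto simp: incseq_def le_fun_def indicator_def)
  also have "\<dots> = (SUP n. \<integral>\<^sup>+ r. f r * indicator {exp (- real n)..exp (real n)} r \<partial>lborel)"
  proof (intro SUP_cong refl)
    fix n :: nat
    show "(\<integral>\<^sup>+ x. f (exp x) * ennreal (exp x) * indicator {- real n..real n} x \<partial>lborel)
        = (\<integral>\<^sup>+ r. f r * indicator {exp (- real n)..exp (real n)} r \<partial>lborel)"
    proof (cases "n = 0")
      \<comment> \<open>The substitution rule requires a nondegenerate interval; for n = 0 both
        sides are integrals over a single point.\<close>
      case True
      have triv: "(\<integral>\<^sup>+ x. g x * indicator {a..a} x \<partial>lborel) = 0" for g :: "real \<Rightarrow> ennreal" and a
      proof -
        have "(\<integral>\<^sup>+ x. g x * indicator {a..a} x \<partial>lborel) = (\<integral>\<^sup>+ x. 0 \<partial>(lborel :: real measure))"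
          using AE_lborel_singleton[of a] by (intro nn_integral_cong_AE) (auto elim!: eventually_mono simp: indicator_def)
        then show ?thesis
          by simp
      qed
      show ?thesis
        using triv[of "\<lambda>x. f (exp x) * ennreal (exp x)" 0] triv[of f 1]
        unfolding True of_nat_0 minus_zero exp_zero by (simp only:)
    next
      case False
      show ?thesis
      proof (rule nn_integral_substitution_aux[symmetric])
        show "continuous_on {- real n..real n} exp"
          by (intro continuous_intros)
        show "(exp has_real_derivative exp x) (at x)" for x :: real
          by (rule DERIV_exp)
      qed (use False in simp_all)
    qed
  qed
  also have "\<dots> = (\<integral>\<^sup>+ r. (SUP n. f r * indicator {exp (- real n)..exp (real n)} r) \<partial>lborel)"
    by (intro nn_integral_monotone_convergence_SUP[symmetric])
      (auto simp: incseq_def le_fun_def indicator_def,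
       (meson exp_le_cancel_iff neg_le_iff_le of_nat_le_iff order_trans)+)
  also have "\<dots> = (\<integral>\<^sup>+ r. f r * indicator {0<..} r \<partial>lborel)"
  proof (intro nn_integral_cong)
    fix r :: real
    show "(SUP n. f r * indicator {exp (- real n)..exp (real n)} r) = f r * indicator {0<..} r"
    proof (cases "r > 0")
      case True
      obtain n where n: "\<bar>ln r\<bar> \<le> real n"
        using real_arch_simple by blast
      have "exp (- real n) \<le> exp (ln r)" "exp (ln r) \<le> exp (real n)"
        using n unfolding exp_le_cancel_iff by linarith+
      then have "f r * indicator {0<..} r \<le> (SUP n. f r * indicator {exp (- real n)..exp (real n)} r)"
        using True by (intro SUP_upper2[of n]) (auto simp: indicator_def)
      moreover have "(SUP n. f r * indicator {exp (- real n)..exp (real n)} r) \<le> f r * indicator {0<..} r"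
        using True by (intro SUP_least) (auto simp: indicator_def)
      ultimately show ?thesis
        by (rule antisym[rotated])
    next
      case False
      then have "\<not> exp (- real n) \<le> r" for n
        by (meson exp_gt_zero less_le_trans)
      then show ?thesis
        using False by simp
    qed
  qed
  finally show ?thesis .
qed

text \<open>Polar coordinates are the complex exponential: it is injective on the open strip of
  height 2 * pi, its Jacobian is |exp z|^2, and its image of the strip covers everything off the
  real axis, which is a null set.\<close>

lemma lborel_complex_eq_distr_exp:
  "(lborel :: complex measure)
   = distr (density lborel (\<lambda>z. ennreal ((norm (exp z))\<^sup>2) * indicator {z. 0 < Im z \<and> Im z < 2 * pi} z)) borel exp"
proof (rule measure_eqI)
  define S where "S = {z. 0 < Im z \<and> Im z < 2 * pi}"
  have "open S"
    unfolding S_def by (intro open_Collect_conj open_Collect_less continuous_intros)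
  have "inj_on exp S"
    by (auto simp: S_def inj_on_def intro!: exp_complex_eqI)
  have [measurable]: "S \<in> sets borel"
    using \<open>open S\<close> by simp
  have [measurable]: "exp \<in> borel_measurable (borel :: complex measure)"
    by (intro borel_measurable_continuous_onI continuous_intros)
  have im: "z \<in> exp ` S" if "Im z \<noteq> 0" for z
  proof -
    have "Arg2pi z \<noteq> 0"
      using that Arg2pi_eq_0 complex_is_Real_iff by blast
    then have "Complex (ln (norm z)) (Arg2pi z) \<in> S"
      using Arg2pi[of z] by (simp add: S_def)
    moreover have "exp (Complex (ln (norm z)) (Arg2pi z)) = of_real (norm z) * exp (\<i> * of_real (Arg2pi z))"
      using that by (auto simp: exp_eq_polar[of "Complex a b" for a b] cis_conv_exp)
    then have "z = exp (Complex (ln (norm z)) (Arg2pi z))"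
      using Arg2pi_eq[of z] by metis
    ultimately show ?thesis
      by blast
  qed
  have null: "emeasure lborel {z. Im z = 0} = 0"
  proof -
    have "negligible {z. \<i> \<bullet> z = 0}"
      by (intro negligible_hyperplane) auto
    then have "negligible {z. Im z = 0}"
      by simp
    moreover have "closed {z. Im z = 0}"
      by (intro closed_Collect_eq continuous_intros)
    ultimately show ?thesis
      by (simp add: negligible_iff_emeasure0)
  qed
  fix B :: "complex set"
  assume "B \<in> sets lborel"
  then have [measurable]: "B \<in> sets borel"
    by simp
  define A where "A = exp -` B \<inter> S"
  have "exp -` B \<inter> space borel \<in> sets (borel :: complex measure)"
    by measurable
  then have vB [measurable]: "exp -` B \<in> sets borel"
    by simp
  then have A [measurable]: "A \<in> sets borel"
    by (simp add: A_def)
  have expA: "exp ` A = B \<inter> exp ` S"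
    by (auto simp: A_def)
  have expA_b: "exp ` A \<in> sets borel"
    by (rule borel_image_holomorphic_inj[OF _ \<open>open S\<close> \<open>inj_on exp S\<close> A]) (auto simp: A_def intro!: holomorphic_intros)
  \<comment> \<open>Off the null real axis \<open>B\<close> is the image of its preimage in the
    strip, so the area formula for injective maps computes its measure.\<close>
  have "emeasure lborel B \<le> emeasure lborel (exp ` A \<union> {z. Im z = 0})"
    using expA_b im unfolding expA
    by (intro emeasure_mono) (auto intro!: sets.Un closed_Collect_eq continuous_intros borel_closed)
  also have "\<dots> \<le> emeasure lborel (exp ` A) + emeasure lborel {z. Im z = 0}"
    using expA_b by (intro emeasure_subadditive) (auto intro!: closed_Collect_eq continuous_intros borel_closed)
  finally have "emeasure lborel B = emeasure lborel (exp ` A)"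
    unfolding null using expA by (intro antisym) (auto intro!: emeasure_mono)
  also have "\<dots> = (\<integral>\<^sup>+ z. ennreal ((norm (deriv exp z))\<^sup>2) * indicator A z \<partial>lborel)"
    by (rule emeasure_holomorphic_inj_image[OF _ \<open>open S\<close> \<open>inj_on exp S\<close> A]) (auto simp: A_def intro!: holomorphic_intros)
  also have "\<dots> = (\<integral>\<^sup>+ z. ennreal ((norm (exp z))\<^sup>2) * indicator S z * indicator (exp -` B) z \<partial>lborel)"
    by (intro nn_integral_cong) (auto simp: A_def indicator_def DERIV_imp_deriv[OF DERIV_exp])
  also have "\<dots> = emeasure (distr (density lborel (\<lambda>z. ennreal ((norm (exp z))\<^sup>2) * indicator S z)) borel exp) B"
    by (simp add: emeasure_distr emeasure_density)
  finally show "emeasure lborel B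
     = emeasure (distr (density lborel (\<lambda>z. ennreal ((norm (exp z))\<^sup>2) * indicator {z. 0 < Im z \<and> Im z < 2 * pi} z)) borel exp) B"
    unfolding S_def .
qed simp

lemma nn_integral_polar:
  assumes [measurable]: "g \<in> borel_measurable borel"
  shows "(\<integral>\<^sup>+ z. g z \<partial>lborel)
    = (\<integral>\<^sup>+ r \<in> {0<..}. (\<integral>\<^sup>+ t \<in> {0..2 * pi}. g (of_real r * cis t) \<partial>lborel) * ennreal r \<partial>lborel)"
proof -
  define H where "H r = (\<integral>\<^sup>+ t \<in> {0..2 * pi}. g (of_real r * cis t) \<partial>lborel)" for r
  have [measurable]: "exp \<in> borel_measurable (borel :: complex measure)"
    by (intro borel_measurable_continuous_onI continuous_intros)
  have [measurable]: "(\<lambda>p. of_real (fst p) * cis (snd p)) \<in> borel \<Otimes>\<^sub>M borel \<rightarrow>\<^sub>M borel"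
    unfolding borel_prod by (intro borel_measurable_continuous_onI continuous_intros)
  have [measurable]: "cis \<in> borel_measurable borel"
    by (intro borel_measurable_continuous_onI continuous_intros)
  have [measurable]: "{z. 0 < Im z \<and> Im z < 2 * pi} \<in> sets borel"
    by (intro borel_open open_Collect_conj open_Collect_less continuous_intros)
  have [measurable]: "H \<in> borel_measurable borel"
    unfolding H_def by measurable
  have "(\<integral>\<^sup>+ z. g z \<partial>lborel)
      = (\<integral>\<^sup>+ z. ennreal ((norm (exp z))\<^sup>2) * indicator {z. 0 < Im z \<and> Im z < 2 * pi} z * g (exp z) \<partial>lborel)"
    by (subst lborel_complex_eq_distr_exp, subst nn_integral_distr) (simp_all add: nn_integral_density)
  also have "\<dots> = (\<integral>\<^sup>+ x. (\<integral>\<^sup>+ y. ennreal ((norm (exp (Complex x y)))\<^sup>2)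
       * indicator {z. 0 < Im z \<and> Im z < 2 * pi} (Complex x y) * g (exp (Complex x y)) \<partial>lborel) \<partial>lborel)"
    by (rule nn_integral_complex_pair) measurable
  \<comment> \<open>Of the two factors \<open>exp x\<close>, one is the radius in the polar area
    element and the other is absorbed by the substitution r = exp x. Closing the angular interval
    adds only two points.\<close>
  also have "\<dots> = (\<integral>\<^sup>+ x. H (exp x) * ennreal (exp x) * ennreal (exp x) \<partial>lborel)"
  proof (intro nn_integral_cong)
    fix x :: real
    have "(\<integral>\<^sup>+ y. ennreal ((norm (exp (Complex x y)))\<^sup>2)
       * indicator {z. 0 < Im z \<and> Im z < 2 * pi} (Complex x y) * g (exp (Complex x y)) \<partial>lborel)
      = (\<integral>\<^sup>+ y. (g (of_real (exp x) * cis y) * indicator {0..2 * pi} y) * ennreal ((exp x)\<^sup>2) \<partial>lborel)"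
      using AE_lborel_singleton[of "0::real"] AE_lborel_singleton[of "2 * pi"]
      by (intro nn_integral_cong_AE) (auto elim!: eventually_elim2 simp: indicator_def exp_eq_polar norm_mult mult.commute)
    also have "\<dots> = H (exp x) * ennreal ((exp x)\<^sup>2)"
      unfolding H_def by (subst nn_integral_multc) auto
    finally show "(\<integral>\<^sup>+ y. ennreal ((norm (exp (Complex x y)))\<^sup>2)
       * indicator {z. 0 < Im z \<and> Im z < 2 * pi} (Complex x y) * g (exp (Complex x y)) \<partial>lborel)
      = H (exp x) * ennreal (exp x) * ennreal (exp x)"
      by (simp add: power2_eq_square ennreal_mult mult.assoc)
  qed
  also have "\<dots> = (\<integral>\<^sup>+ r. H r * ennreal r * indicator {0<..} r \<partial>lborel)"
    by (rule nn_integral_exp_substitution[of "\<lambda>r. H r * ennreal r"]) measurable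
  finally show ?thesis
    by (simp add: H_def)
qed

section \<open>Area and valency\<close>

text \<open>The points of a finite fibre are isolated, so f - w is not identically zero near any of
  them, and every zero has order at least 1.\<close>

lemma card_preimage_le_num_solutions:
  assumes f: "f holomorphic_on G" and G: "open G" and fin: "finite {z \<in> G. f z = w}"
  shows "of_nat (card {z \<in> G. f z = w}) \<le> num_solutions f G w"
proof -
  have "1 \<le> nat (zorder (\<lambda>u. f u - w) z)" if z: "z \<in> G" "f z = w" for z
  proof -
    have "\<forall>\<^sub>F u in at z. u \<in> G - ({z \<in> G. f z = w} - {z})"
      using G z(1) fin by (intro eventually_at_in_open' open_Diff finite_imp_closed) auto
    moreover have "\<forall>\<^sub>F u in at z. u \<noteq> z"
      by (simp add: eventually_at_filter)
    ultimately have "\<forall>\<^sub>F u in at z. f u - w \<noteq> 0"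
      by eventually_elim auto
    then have "\<exists>\<^sub>F u in at z. f u - w \<noteq> 0"
      by (rule eventually_frequently[rotated]) simp
    moreover have "(\<lambda>u. f u - w) holomorphic_on G"
      using f by (intro holomorphic_intros)
    ultimately have "zorder (\<lambda>u. f u - w) z > 0"
      using zorder_pos_iff[of "\<lambda>u. f u - w" G z] G z by simp
    then show ?thesis
      by simp
  qed
  then have "(\<Sum>z | z \<in> G \<and> f z = w. 1) \<le> (\<Sum>z | z \<in> G \<and> f z = w. nat (zorder (\<lambda>u. f u - w) z))"
    by (intro sum_mono) auto
  then have "card {z \<in> G. f z = w} \<le> (\<Sum>z | z \<in> G \<and> f z = w. nat (zorder (\<lambda>u. f u - w) z))"
    by simp
  then show ?thesis
    unfolding num_solutions_def using fin by (simp only: if_True of_nat_le_iff)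
qed

text \<open>If \<open>w\<close> lies in several images, disjointness of the pieces provides distinct
  preimages, one per piece.\<close>

lemma suminf_indicator_images_le_num_solutions:
  assumes f: "f holomorphic_on G" and G: "open G"
    and E: "disjoint_family E" "\<And>i::nat. E i \<subseteq> G"
  shows "(\<Sum>i. indicator (f ` E i) w) \<le> num_solutions f G w"
proof (cases "finite {z \<in> G. f z = w}")
  case False
  then show ?thesis
    unfolding num_solutions_def by (simp only: if_False infinity_ennreal_def top_greatest)
next
  case True
  define I where "I = {i. w \<in> f ` E i}"
  have "\<forall>i\<in>I. \<exists>z. z \<in> E i \<and> f z = w"
    by (auto simp: I_def)
  then obtain c where c: "\<And>i. i \<in> I \<Longrightarrow> c i \<in> E i \<and> f (c i) = w"
    by metis
  have inj: "inj_on c I"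
    using c E(1) by (auto simp: inj_on_def disjoint_family_on_def) (metis IntI empty_iff)
  have sub: "c ` I \<subseteq> {z \<in> G. f z = w}"
    using c E(2) by auto
  have finI: "finite I"
    using inj sub True by (metis finite_imageD finite_subset)
  have "(\<Sum>i. indicator (f ` E i) w) = (\<Sum>i\<in>I. indicator (f ` E i) w :: ennreal)"
    using finI by (intro suminf_finite) (auto simp: I_def indicator_def)
  also have "\<dots> = of_nat (card I)"
    by (simp add: I_def)
  also have "\<dots> \<le> of_nat (card {z \<in> G. f z = w})"
    using inj sub True by (simp add: card_inj_on_le)
  also have "\<dots> \<le> num_solutions f G w"
    using card_preimage_le_num_solutions[OF f G True] .
  finally show ?thesis .
qed

text \<open>Local injectivity at noncritical points, together with the Lindelof property.\<close>

lemma holomorphic_noncritical_decomposition: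
  assumes f: "f holomorphic_on G" and G: "open G"
  obtains U :: "nat \<Rightarrow> complex set"
  where "\<And>i. open (U i)" "\<And>i. U i \<subseteq> G" "\<And>i. inj_on f (U i)"
    "{z \<in> G. deriv f z \<noteq> 0} \<subseteq> (\<Union>i. U i)"
proof -
  define F where "F = {B. open B \<and> B \<subseteq> G \<and> inj_on f B}"
  obtain F' where F': "F' \<subseteq> F" "countable F'" "\<Union>F' = \<Union>F"
    using Lindelof[of F] unfolding F_def by blast
  have cov: "{z \<in> G. deriv f z \<noteq> 0} \<subseteq> \<Union>F"
  proof
    fix z assume "z \<in> {z \<in> G. deriv f z \<noteq> 0}"
    then obtain r where "r > 0" "ball z r \<subseteq> G" "inj_on f (ball z r)"
      using has_complex_derivative_locally_injective[OF f _ G] by auto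
    then have "ball z r \<in> F" "z \<in> ball z r"
      by (auto simp: F_def)
    then show "z \<in> \<Union>F"
      by blast
  qed
  \<comment> \<open>Adjoining the empty set makes the family nonempty, as its enumeration by
    \<open>from_nat_into\<close> requires.\<close>
  have ne: "insert {} F' \<noteq> {}"
    by simp
  have cnt: "countable (insert {} F')"
    using F'(2) by simp
  have sub: "from_nat_into (insert {} F') i \<in> F" for i
    using from_nat_into[OF ne, of i] F'(1) by (auto simp: F_def)
  show thesis
  proof (rule that[of "from_nat_into (insert {} F')"])
    have "(\<Union>i. from_nat_into (insert {} F') i) = \<Union>(insert {} F')"
      using range_from_nat_into[OF ne cnt] by simp
    then show "{z \<in> G. deriv f z \<noteq> 0} \<subseteq> (\<Union>i. from_nat_into (insert {} F') i)"
      using cov F'(3) by simp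
  qed (use sub in \<open>auto simp: F_def\<close>)
qed

lemma borel_measurable_indicator_holomorphic:
  assumes "f holomorphic_on G" "open G"
  shows "(\<lambda>z. indicator G z *\<^sub>R f z) \<in> borel_measurable borel"
  using assms by (intro borel_measurable_continuous_on_indicator holomorphic_on_imp_continuous_on) auto

text \<open>The pieces \<open>E i\<close> are disjoint and f is injective on each, so the integral
  is the sum of the areas of their images. Polar coordinates are applied to the sum of the
  indicators of these images, which is Borel; \<open>num_solutions\<close> enters only afterwards,
  by pointwise comparison.\<close>

lemma nn_integral_deriv_le_num_solutions:
  assumes f: "f holomorphic_on G" and G: "open G" and T: "open T"
  shows "(\<integral>\<^sup>+ z \<in> {z \<in> G. f z \<in> T}. ennreal ((norm (deriv f z))\<^sup>2) \<partial>lborel)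
    \<le> (\<integral>\<^sup>+ r \<in> {0<..}. (\<integral>\<^sup>+ t \<in> {0..2 * pi}. num_solutions f G (of_real r * cis t) * indicator T (of_real r * cis t) \<partial>lborel)
          * ennreal r \<partial>lborel)"
proof -
  obtain U :: "nat \<Rightarrow> complex set" where U: "\<And>i. open (U i)" "\<And>i. U i \<subseteq> G" "\<And>i. inj_on f (U i)"
    "{z \<in> G. deriv f z \<noteq> 0} \<subseteq> (\<Union>i. U i)"
    using holomorphic_noncritical_decomposition[OF f G] by metis
  define W where "W = {z \<in> G. f z \<in> T}"
  have "open (G \<inter> f -` T)"
    using f G T by (intro continuous_open_preimage holomorphic_on_imp_continuous_on)
  then have "open W"
    by (simp add: W_def Int_def vimage_def)
  define E where "E i = disjointed U i \<inter> W" for i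
  have E_borel [measurable]: "E i \<in> sets borel" for i
  proof -
    have "range (disjointed U) \<subseteq> sets borel"
      using U(1) by (intro sets.range_disjointed_sets) auto
    then show ?thesis
      using \<open>open W\<close> unfolding E_def by (auto intro!: sets.Int[OF _ borel_open])
  qed
  have E_U: "E i \<subseteq> U i" for i
    using disjointed_subset[of U i] by (auto simp: E_def)
  have E_disj: "disjoint_family E"
    using disjoint_family_disjointed[of U] by (auto simp: E_def disjoint_family_on_def)
  have UN_E: "(\<Union>i. E i) = (\<Union>i. U i) \<inter> W"
    using UN_disjointed_eq[of U] unfolding E_def by blast
  have fE: "f ` E i \<in> sets borel" for i
    using borel_image_holomorphic_inj[OF _ U(1) U(3) E_borel E_U] f U(2) holomorphic_on_subset by blast
  have fEm: "emeasure lborel (f ` E i) = (\<integral>\<^sup>+ z. ennreal ((norm (deriv f z))\<^sup>2) * indicator (E i) z \<partial>lborel)" for i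
    using emeasure_holomorphic_inj_image[OF _ U(1) U(3) E_borel E_U] f U(2) holomorphic_on_subset by blast
  have "(\<lambda>z. indicator G z *\<^sub>R deriv f z) \<in> borel_measurable borel"
    using f G by (intro borel_measurable_indicator_holomorphic holomorphic_deriv)
  then have "(\<lambda>z. ennreal ((norm (indicator G z *\<^sub>R deriv f z))\<^sup>2) * indicator (E i) z) \<in> borel_measurable borel" for i
    by measurable
  moreover have "(\<lambda>z. ennreal ((norm (indicator G z *\<^sub>R deriv f z))\<^sup>2) * indicator (E i) z)
      = (\<lambda>z. ennreal ((norm (deriv f z))\<^sup>2) * indicator (E i) z)" for i
    using E_U U(2) by (auto simp: fun_eq_iff indicator_def)
  ultimately have meas: "(\<lambda>z. ennreal ((norm (deriv f z))\<^sup>2) * indicator (E i) z) \<in> borel_measurable borel" for i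
    by simp
  have "(\<integral>\<^sup>+ z \<in> W. ennreal ((norm (deriv f z))\<^sup>2) \<partial>lborel)
      = (\<integral>\<^sup>+ z. (\<Sum>i. ennreal ((norm (deriv f z))\<^sup>2) * indicator (E i) z) \<partial>lborel)"
  proof (intro nn_integral_cong)
    fix z
    have "(\<Sum>i. ennreal ((norm (deriv f z))\<^sup>2) * indicator (E i) z)
        = ennreal ((norm (deriv f z))\<^sup>2) * indicator (\<Union>i. E i) z"
      using suminf_indicator[OF E_disj, of z] by simp
    \<comment> \<open>Critical points may be missed by every \<open>E i\<close>, but the integrand
      vanishes there.\<close>
    also have "\<dots> = ennreal ((norm (deriv f z))\<^sup>2) * indicator W z"
    proof (cases "deriv f z = 0 \<or> z \<notin> W")
      case True
      then show ?thesis
        using UN_E by auto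
    next
      case False
      then have "z \<in> (\<Union>i. E i)" "z \<in> W"
        using U(4) UN_E by (auto simp: W_def)
      then show ?thesis
        by simp
    qed
    finally show "ennreal ((norm (deriv f z))\<^sup>2) * indicator W z
       = (\<Sum>i. ennreal ((norm (deriv f z))\<^sup>2) * indicator (E i) z)" ..
  qed
  also have "\<dots> = (\<Sum>i. emeasure lborel (f ` E i))"
    unfolding fEm using meas by (intro nn_integral_suminf) simp
  also have "\<dots> = (\<Sum>i. \<integral>\<^sup>+ w. indicator (f ` E i) w \<partial>lborel)"
    using fE by (intro suminf_cong) simp
  also have "\<dots> = (\<integral>\<^sup>+ w. (\<Sum>i. indicator (f ` E i) w) \<partial>lborel)"
    using fE by (intro nn_integral_suminf[symmetric]) simp
  also have "\<dots> = (\<integral>\<^sup>+ r \<in> {0<..}. (\<integral>\<^sup>+ t \<in> {0..2 * pi}. (\<Sum>i. indicator (f ` E i) (of_real r * cis t)) \<partial>lborel)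
          * ennreal r \<partial>lborel)"
  proof -
    note [measurable] = fE
    show ?thesis
      by (rule nn_integral_polar) measurable
  qed
  also have "\<dots> \<le> (\<integral>\<^sup>+ r \<in> {0<..}. (\<integral>\<^sup>+ t \<in> {0..2 * pi}. num_solutions f G (of_real r * cis t) * indicator T (of_real r * cis t) \<partial>lborel)
          * ennreal r \<partial>lborel)"
  proof -
    have "(\<Sum>i. indicator (f ` E i) w) \<le> num_solutions f G w * indicator T w" for w
    proof (cases "w \<in> T")
      case True
      have "E i \<subseteq> G" for i
        using E_U U(2) by blast
      then show ?thesis
        using suminf_indicator_images_le_num_solutions[OF f G E_disj] True by simp
    next
      case False
      then have "w \<notin> f ` E i" for i
        by (auto simp: E_def W_def)
      then show ?thesis
        by simp
    qed
    then show ?thesis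
      by (intro nn_integral_mono mult_right_mono) auto
  qed
  finally show ?thesis
    unfolding W_def .
qed

text \<open>With the disc of radius R as \<open>T\<close>, the polar integral of the counting
  function stops at radius R, the range that \<open>mean_valent\<close> controls.\<close>

lemma mean_valent_area:
  assumes mv: "mean_valent n f G" and G: "open G" and R: "R > 0"
  shows "(\<integral>\<^sup>+ z \<in> {z \<in> G. norm (f z) < R}. ennreal ((norm (deriv f z))\<^sup>2) \<partial>lborel) \<le> ennreal (pi * n * R\<^sup>2)"
proof -
  define X where "X = (\<integral>\<^sup>+ r \<in> {0..R}.
            (\<integral>\<^sup>+ t \<in> {0..2 * pi}. num_solutions f G (of_real r * cis t) \<partial>lborel) * ennreal r
          \<partial>lborel)"
  have f: "f holomorphic_on G" and X: "ennreal (1 / pi) * X \<le> ennreal (n * R\<^sup>2)"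
    using mv R by (auto simp: mean_valent_def X_def)
  have "(\<integral>\<^sup>+ z \<in> {z \<in> G. norm (f z) < R}. ennreal ((norm (deriv f z))\<^sup>2) \<partial>lborel)
      = (\<integral>\<^sup>+ z \<in> {z \<in> G. f z \<in> ball 0 R}. ennreal ((norm (deriv f z))\<^sup>2) \<partial>lborel)"
    by simp
  also have "\<dots> \<le> (\<integral>\<^sup>+ r \<in> {0<..}. (\<integral>\<^sup>+ t \<in> {0..2 * pi}. num_solutions f G (of_real r * cis t)
          * indicator (ball 0 R) (of_real r * cis t :: complex) \<partial>lborel) * ennreal r \<partial>lborel)"
    by (intro nn_integral_deriv_le_num_solutions f G) auto
  also have "\<dots> \<le> X"
    unfolding X_def
  proof (intro nn_integral_mono)
    fix r :: real
    show "(\<integral>\<^sup>+ t \<in> {0..2 * pi}. num_solutions f G (of_real r * cis t)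
          * indicator (ball 0 R) (of_real r * cis t :: complex) \<partial>lborel) * ennreal r * indicator {0<..} r
       \<le> (\<integral>\<^sup>+ t \<in> {0..2 * pi}. num_solutions f G (of_real r * cis t) \<partial>lborel) * ennreal r * indicator {0..R} r"
    proof (cases "0 < r \<and> r < R")
      case True
      then show ?thesis
        by (simp add: norm_mult)
    next
      case False
      then have "r > 0 \<Longrightarrow> \<not> r < R" by auto
      then show ?thesis
        by (cases "r > 0") (auto simp: norm_mult)
    qed
  qed
  also have "X = ennreal pi * (ennreal (1 / pi) * X)"
    by (simp add: mult.assoc[symmetric] flip: ennreal_mult)
  also have "\<dots> \<le> ennreal pi * ennreal (n * R\<^sup>2)"
    by (intro mult_left_mono X) auto
  also have "\<dots> = ennreal (pi * n * R\<^sup>2)"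
    by (simp add: mult.assoc flip: ennreal_mult')
  finally show ?thesis .
qed

section \<open>Hardy functions\<close>

lemma circle_mean_value:
  assumes f: "f holomorphic_on cball z s" and s: "s > 0"
  shows "((\<lambda>t. f (z + of_real s * cis t)) has_integral 2 * of_real pi * f z) {0..2 * pi}"
proof -
  have "((\<lambda>u. f u / (u - z)) has_contour_integral (2 * of_real pi * \<i> * f z)) (circlepath z s)"
    using Cauchy_integral_circlepath_simple[OF f, of z] s by simp
  then have "((\<lambda>t. f (z + of_real s * cis t) / (z + of_real s * cis t - z) * of_real s * \<i> * cis t)
      has_integral (2 * of_real pi * \<i> * f z)) {0..2 * pi}"
    unfolding circlepath_def by (subst (asm) has_contour_integral_part_circlepath_iff) auto
  then have "((\<lambda>t. - \<i> * (f (z + of_real s * cis t) / (z + of_real s * cis t - z) * of_real s * \<i> * cis t))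
      has_integral (- \<i> * (2 * of_real pi * \<i> * f z))) {0..2 * pi}"
    by (rule has_integral_mult_right)
  moreover have "- \<i> * (f (z + of_real s * cis t) / (z + of_real s * cis t - z) * of_real s * \<i> * cis t)
      = f (z + of_real s * cis t)" for t
    using s by (simp add: field_simps cis_neq_zero)
  moreover have "- \<i> * (2 * of_real pi * \<i> * f z) = 2 * of_real pi * f z"
    by (simp add: field_simps)
  ultimately show ?thesis
    by (simp only:)
qed

text \<open>The tangent to x powr p at \<open>m\<close> lies below the graph. Being affine in x it
  can be integrated, which turns the mean value property into Jensen's inequality for the power
  p.\<close>

lemma powr_tangent_le:
  fixes x m p :: real
  assumes "p > 1" "x \<ge> 0" "m \<ge> 0"
  shows "p * m powr (p - 1) * x \<le> x powr p + (p - 1) * m powr p"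
proof -
  have "x * m powr (p - 1) \<le> x powr p / p + (m powr (p - 1)) powr (p / (p - 1)) / (p / (p - 1))"
    using assms by (intro Youngs_inequality) (auto simp: field_simps)
  also have "\<dots> = x powr p / p + m powr p * (p - 1) / p"
    using assms by (simp add: powr_powr)
  finally have "p * (x * m powr (p - 1)) \<le> p * (x powr p / p + m powr p * (p - 1) / p)"
    using assms by (intro mult_left_mono) auto
  moreover have "p * (x powr p / p + m powr p * (p - 1) / p) = x powr p + (p - 1) * m powr p"
    using assms by (simp add: field_simps)
  ultimately show ?thesis
    by (simp add: mult_ac)
qed

lemma nn_integral_Icc_eq_integral:
  fixes h :: "real \<Rightarrow> real"
  assumes "continuous_on {a..b} h" "\<And>t. t \<in> {a..b} \<Longrightarrow> h t \<ge> 0"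
  shows "(\<integral>\<^sup>+ t \<in> {a..b}. ennreal (h t) \<partial>lborel) = ennreal (integral {a..b} h)"
  using assms by (intro nn_integral_has_integral_lebesgue' integrable_integral integrable_continuous_interval) auto

lemma circle_submean_powr:
  assumes f: "f holomorphic_on cball z s" and s: "s > 0" and p: "p > 1"
  shows "ennreal (2 * pi * norm (f z) powr p)
    \<le> (\<integral>\<^sup>+ t \<in> {0..2 * pi}. ennreal (norm (f (z + of_real s * cis t)) powr p) \<partial>lborel)"
proof -
  define F where "F t = f (z + of_real s * cis t)" for t
  define m where "m = norm (f z)"
  have "z + of_real s * cis t \<in> cball z s" for t
    using s by (simp add: dist_norm norm_mult)
  then have cF: "continuous_on {0..2 * pi} F"
    unfolding F_def
    by (intro continuous_on_compose2[OF holomorphic_on_imp_continuous_on[OF f]] continuous_intros) auto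
  have cFp: "continuous_on {0..2 * pi} (\<lambda>t. norm (F t) powr p)"
    using cF p by (intro continuous_on_powr' continuous_intros) auto
  have "(F has_integral 2 * of_real pi * f z) {0..2 * pi}"
    unfolding F_def using circle_mean_value[OF f s] .
  then have "integral {0..2 * pi} F = 2 * of_real pi * f z"
    by (rule integral_unique)
  then have "2 * pi * m = norm (integral {0..2 * pi} F)"
    by (simp add: m_def norm_mult)
  also have "\<dots> \<le> integral {0..2 * pi} (\<lambda>t. norm (F t))"
    using cF by (intro integral_norm_bound_integral integrable_continuous_interval continuous_intros) auto
  finally have mean: "2 * pi * m \<le> integral {0..2 * pi} (\<lambda>t. norm (F t))" .
  have mp: "m powr (p - 1) * m = m powr p"
  proof (cases "m = 0")
    case False
    then have "m > 0" by (simp add: m_def)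
    then show ?thesis using powr_add[of m "p - 1" 1] by simp
  qed auto
  \<comment> \<open>The tangent inequality at \<open>m = norm (f z)\<close>, integrated over the
    circle. Its constant term takes away p - 1 of the p multiples of 2 * pi * m powr p.\<close>
  have "p * (2 * pi * m powr p) = p * m powr (p - 1) * (2 * pi * m)"
    using mp by (simp add: algebra_simps)
  also have "\<dots> \<le> p * m powr (p - 1) * integral {0..2 * pi} (\<lambda>t. norm (F t))"
    using mean p by (intro mult_left_mono) auto
  also have "\<dots> = integral {0..2 * pi} (\<lambda>t. p * m powr (p - 1) * norm (F t))"
    by simp
  also have "\<dots> \<le> integral {0..2 * pi} (\<lambda>t. norm (F t) powr p + (p - 1) * m powr p)"
  proof (intro integral_le integrable_continuous_interval)
    show "continuous_on {0..2 * pi} (\<lambda>t. p * m powr (p - 1) * norm (F t))"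
      using cF by (intro continuous_intros)
    show "continuous_on {0..2 * pi} (\<lambda>t. norm (F t) powr p + (p - 1) * m powr p)"
      by (rule continuous_on_add[OF cFp continuous_on_const])
    show "p * m powr (p - 1) * norm (F t) \<le> norm (F t) powr p + (p - 1) * m powr p" for t
      using powr_tangent_le[OF p] by (simp add: m_def)
  qed
  also have "\<dots> = integral {0..2 * pi} (\<lambda>t. norm (F t) powr p) + integral {0..2 * pi} (\<lambda>t. (p - 1) * m powr p)"
    by (rule integral_add[OF integrable_continuous_interval[OF cFp] integrable_const_ivl])
  also have "\<dots> = integral {0..2 * pi} (\<lambda>t. norm (F t) powr p) + 2 * pi * (p - 1) * m powr p"
    by simp
  finally have "2 * pi * m powr p \<le> integral {0..2 * pi} (\<lambda>t. norm (F t) powr p)"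
    by (simp add: algebra_simps)
  then show ?thesis
    using nn_integral_Icc_eq_integral[OF cFp] by (simp add: F_def m_def ennreal_leI)
qed

lemma nn_integral_translate_complex:
  fixes h :: "complex \<Rightarrow> ennreal"
  assumes [measurable]: "h \<in> borel_measurable borel"
  shows "(\<integral>\<^sup>+ w. h (z + w) \<partial>lborel) = (\<integral>\<^sup>+ w. h w \<partial>lborel)"
  by (subst (2) lborel_distr_plus[of z, symmetric], subst nn_integral_distr) simp_all

lemma borel_measurable_norm_powr_holomorphic:
  assumes "f holomorphic_on G" "open G" "A \<in> sets borel" "A \<subseteq> G"
  shows "(\<lambda>z. ennreal (norm (f z) powr p) * indicator A z) \<in> borel_measurable borel"
proof -
  note [measurable] = assms(3)
  have [measurable]: "(\<lambda>z. indicator G z *\<^sub>R f z) \<in> borel_measurable borel"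
    using assms by (intro borel_measurable_indicator_holomorphic)
  have "(\<lambda>z. ennreal (norm (indicator G z *\<^sub>R f z) powr p) * indicator A z) \<in> borel_measurable borel"
    by measurable
  moreover have "(\<lambda>z. ennreal (norm (indicator G z *\<^sub>R f z) powr p) * indicator A z)
      = (\<lambda>z. ennreal (norm (f z) powr p) * indicator A z)"
    using assms(4) by (auto simp: fun_eq_iff indicator_def)
  ultimately show ?thesis
    by simp
qed

lemma nn_integral_ident_Ioo:
  assumes "\<rho> > 0"
  shows "(\<integral>\<^sup>+ s \<in> {0<..<\<rho>}. ennreal s \<partial>lborel) = ennreal (\<rho>\<^sup>2 / 2)"
proof -
  have "((\<lambda>x. x) has_integral (\<rho>\<^sup>2 / 2 - 0\<^sup>2 / 2)) {0..\<rho>}"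
    using assms
    by (intro fundamental_theorem_of_calculus)
      (auto intro!: derivative_eq_intros simp flip: has_real_derivative_iff_has_vector_derivative)
  then have "((\<lambda>x. x) has_integral (\<rho>\<^sup>2 / 2)) {0<..<\<rho>}"
    using has_integral_Icc_iff_Ioo by fastforce
  then show ?thesis
    by (intro nn_integral_has_integral_lebesgue') auto
qed

text \<open>The circle estimate integrated against s over 0 < s < \<rho>, in polar coordinates
  centred at z.\<close>

lemma ball_submean_powr:
  assumes f: "f holomorphic_on ball z \<rho>" and \<rho>: "\<rho> > 0" and p: "p > 1"
  shows "ennreal (pi * \<rho>\<^sup>2 * norm (f z) powr p)
    \<le> (\<integral>\<^sup>+ w \<in> ball z \<rho>. ennreal (norm (f w) powr p) \<partial>lborel)"
proof -
  define h where "h w = ennreal (norm (f w) powr p) * indicator (ball z \<rho>) w" for w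
  have [measurable]: "h \<in> borel_measurable borel"
    unfolding h_def using f by (intro borel_measurable_norm_powr_holomorphic[where G = "ball z \<rho>"]) auto
  have "ennreal (pi * \<rho>\<^sup>2 * norm (f z) powr p) = ennreal (2 * pi * norm (f z) powr p) * ennreal (\<rho>\<^sup>2 / 2)"
    by (subst ennreal_mult[symmetric]) (auto simp: field_simps)
  also have "\<dots> = (\<integral>\<^sup>+ s. ennreal (2 * pi * norm (f z) powr p) * (ennreal s * indicator {0<..<\<rho>} s) \<partial>lborel)"
    by (subst nn_integral_cmult) (simp_all add: nn_integral_ident_Ioo[OF \<rho>])
  also have "\<dots> \<le> (\<integral>\<^sup>+ s \<in> {0<..}. (\<integral>\<^sup>+ t \<in> {0..2 * pi}. h (z + of_real s * cis t) \<partial>lborel) * ennreal s \<partial>lborel)"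
  proof (intro nn_integral_mono)
    fix s :: real
    show "ennreal (2 * pi * norm (f z) powr p) * (ennreal s * indicator {0<..<\<rho>} s)
      \<le> (\<integral>\<^sup>+ t \<in> {0..2 * pi}. h (z + of_real s * cis t) \<partial>lborel) * ennreal s * indicator {0<..} s"
    proof (cases "0 < s \<and> s < \<rho>")
      case True
      then have "f holomorphic_on cball z s"
        using f by (auto intro: holomorphic_on_subset)
      then have "ennreal (2 * pi * norm (f z) powr p)
          \<le> (\<integral>\<^sup>+ t \<in> {0..2 * pi}. ennreal (norm (f (z + of_real s * cis t)) powr p) \<partial>lborel)"
        using True p by (intro circle_submean_powr) auto
      also have "\<dots> = (\<integral>\<^sup>+ t \<in> {0..2 * pi}. h (z + of_real s * cis t) \<partial>lborel)"
        using True by (intro nn_integral_cong) (auto simp: h_def dist_norm norm_mult)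
      finally show ?thesis
        using True by (simp add: mult_right_mono)
    qed (auto simp: indicator_def)
  qed
  also have "\<dots> = (\<integral>\<^sup>+ w. h (z + w) \<partial>lborel)"
    by (rule nn_integral_polar[symmetric]) measurable
  also have "\<dots> = (\<integral>\<^sup>+ w. h w \<partial>lborel)"
    by (rule nn_integral_translate_complex) measurable
  finally show ?thesis
    by (simp add: h_def)
qed

section \<open>Functions of Hardy norm at most 1\<close>

text \<open>The circle integrals are taken in \<open>ennreal\<close> so that the bound can be
  integrated directly in polar coordinates.\<close>

definition unit_hardy :: "real \<Rightarrow> (complex \<Rightarrow> complex) \<Rightarrow> bool" where
  "unit_hardy p f \<longleftrightarrow> f holomorphic_on ball 0 1 \<and>
     (\<forall>r. 0 \<le> r \<longrightarrow> r < 1 \<longrightarrow>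
       (\<integral>\<^sup>+ t \<in> {0..2 * pi}. ennreal (norm (f (of_real r * cis t)) powr p) \<partial>lborel) \<le> ennreal (2 * pi))"

text \<open>Polar coordinates, with the factor r \<le> 1 of the area element dropped. A negative
  \<open>a\<close> is allowed, so that an annulus can be thickened inwards past the origin.\<close>

lemma unit_hardy_annulus:
  assumes f: "unit_hardy p f" and ab: "a \<le> b" "b \<le> 1"
  shows "(\<integral>\<^sup>+ z \<in> {z. a \<le> norm z \<and> norm z < b}. ennreal (norm (f z) powr p) \<partial>lborel) \<le> ennreal (2 * pi * (b - a))"
proof -
  define h where "h z = ennreal (norm (f z) powr p) * indicator {z. a \<le> norm z \<and> norm z < b} z" for z
  have "{z :: complex. a \<le> norm z \<and> norm z < b} = {z. a \<le> norm z} \<inter> {z. norm z < b}"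
    by auto
  also have "\<dots> \<in> sets borel"
    by (intro sets.Int borel_open borel_closed open_Collect_less closed_Collect_le continuous_intros)
  finally have [measurable]: "h \<in> borel_measurable borel"
    unfolding h_def using f ab
    by (intro borel_measurable_norm_powr_holomorphic[where G = "ball 0 1"]) (auto simp: unit_hardy_def)
  have "(\<integral>\<^sup>+ z. h z \<partial>lborel)
      = (\<integral>\<^sup>+ r \<in> {0<..}. (\<integral>\<^sup>+ t \<in> {0..2 * pi}. h (of_real r * cis t) \<partial>lborel) * ennreal r \<partial>lborel)"
    by (rule nn_integral_polar) measurable
  also have "\<dots> \<le> (\<integral>\<^sup>+ r. ennreal (2 * pi) * indicator {a..b} r \<partial>lborel)"
  proof (intro nn_integral_mono)
    fix r :: real
    show "(\<integral>\<^sup>+ t \<in> {0..2 * pi}. h (of_real r * cis t) \<partial>lborel) * ennreal r * indicator {0<..} r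
        \<le> ennreal (2 * pi) * indicator {a..b} r"
    proof (cases "0 < r \<and> a \<le> r \<and> r < b")
      case True
      have "(\<integral>\<^sup>+ t \<in> {0..2 * pi}. h (of_real r * cis t) \<partial>lborel) * ennreal r \<le> ennreal (2 * pi) * 1"
      proof (intro mult_mono)
        have "(\<integral>\<^sup>+ t \<in> {0..2 * pi}. h (of_real r * cis t) \<partial>lborel)
            = (\<integral>\<^sup>+ t \<in> {0..2 * pi}. ennreal (norm (f (of_real r * cis t)) powr p) \<partial>lborel)"
          using True by (intro nn_integral_cong) (auto simp: h_def norm_mult)
        also have "\<dots> \<le> ennreal (2 * pi)"
          using f True ab by (auto simp: unit_hardy_def)
        finally show "(\<integral>\<^sup>+ t \<in> {0..2 * pi}. h (of_real r * cis t) \<partial>lborel) \<le> ennreal (2 * pi)" .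
      qed (use True ab in auto)
      then show ?thesis
        using True by simp
    next
      case False
      then have "r > 0 \<Longrightarrow> h (of_real r * cis t) = 0" for t
        by (auto simp: h_def norm_mult)
      then show ?thesis
        by (cases "r > 0") auto
    qed
  qed
  also have "\<dots> = ennreal (2 * pi * (b - a))"
    using ab by (simp add: nn_integral_cmult ennreal_mult)
  finally show ?thesis
    by (simp add: h_def)
qed

text \<open>The disc lies in an annulus of width 2 * \<rho>, whence a bound that is linear in
  \<rho>.\<close>

lemma unit_hardy_ball:
  assumes f: "unit_hardy p f" and \<rho>: "\<rho> > 0" "norm z + \<rho> \<le> 1"
  shows "(\<integral>\<^sup>+ w \<in> ball z \<rho>. ennreal (norm (f w) powr p) \<partial>lborel) \<le> ennreal (4 * pi * \<rho>)"
proof -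
  have "w \<in> {w. norm z - \<rho> \<le> norm w \<and> norm w < norm z + \<rho>}" if "w \<in> ball z \<rho>" for w
    using that norm_triangle_ineq3[of z w] by (auto simp: dist_norm abs_if split: if_splits)
  then have "(\<integral>\<^sup>+ w \<in> ball z \<rho>. ennreal (norm (f w) powr p) \<partial>lborel)
      \<le> (\<integral>\<^sup>+ w \<in> {w. norm z - \<rho> \<le> norm w \<and> norm w < norm z + \<rho>}. ennreal (norm (f w) powr p) \<partial>lborel)"
    by (intro nn_integral_mono mult_left_mono indicator_leI) auto
  also have "\<dots> \<le> ennreal (2 * pi * ((norm z + \<rho>) - (norm z - \<rho>)))"
    using f \<rho> by (intro unit_hardy_annulus) auto
  also have "2 * pi * ((norm z + \<rho>) - (norm z - \<rho>)) = 4 * pi * \<rho>"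
    by simp
  finally show ?thesis .
qed

text \<open>On the largest disc about z inside the unit disc, the sub-mean value property and the
  linear bound combine to pi * \<rho>^2 * |f z| powr p \<le> 4 * pi * \<rho>.\<close>

lemma unit_hardy_growth:
  assumes f: "unit_hardy p f" and z: "norm z < 1" and p: "p > 1"
  shows "norm (f z) powr p \<le> 4 / (1 - norm z)"
proof -
  define \<rho> where "\<rho> = 1 - norm z"
  have \<rho>: "\<rho> > 0" "norm z + \<rho> \<le> 1"
    using z by (auto simp: \<rho>_def)
  have "ball z \<rho> \<subseteq> ball 0 1"
    using \<rho> by (auto simp: subset_iff dist_norm) (smt (verit) norm_triangle_sub norm_minus_commute)
  then have "f holomorphic_on ball z \<rho>"
    using f by (auto simp: unit_hardy_def intro: holomorphic_on_subset)
  from ball_submean_powr[OF this \<rho>(1) p] unit_hardy_ball[OF f \<rho>]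
  have "ennreal (pi * \<rho>\<^sup>2 * norm (f z) powr p) \<le> ennreal (4 * pi * \<rho>)"
    by (rule order_trans)
  then have "pi * \<rho>\<^sup>2 * norm (f z) powr p \<le> 4 * pi * \<rho>"
    using \<rho> by (subst (asm) ennreal_le_iff) auto
  then have "\<rho> * norm (f z) powr p \<le> 4"
    using \<rho> by (simp add: power2_eq_square)
  then show ?thesis
    using \<rho> by (simp add: \<rho>_def field_simps)
qed

text \<open>Turns the Hardy estimate on an annulus into an estimate of its area.\<close>

lemma unit_hardy_one: "unit_hardy p (\<lambda>_. 1)"
  by (simp add: unit_hardy_def)

text \<open>Cauchy's inequality on the circle of radius \<rho> / 2 about z. Discs of the same radius
  about its points stay in \<open>ball z \<rho>\<close>, so the sub-mean value property bounds f on
  the circle by the local integral.\<close>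

lemma deriv_powr_le_nn_integral_ball:
  assumes f: "unit_hardy p f" and p: "p > 1" and \<rho>: "\<rho> > 0" "norm z + \<rho> \<le> 1"
  shows "ennreal (norm (deriv f z) powr p)
    \<le> ennreal ((2 / \<rho>) powr p * 4 / (pi * \<rho>\<^sup>2)) * (\<integral>\<^sup>+ w \<in> ball z \<rho>. ennreal (norm (f w) powr p) \<partial>lborel)"
proof -
  define J where "J = (\<integral>\<^sup>+ w \<in> ball z \<rho>. ennreal (norm (f w) powr p) \<partial>lborel)"
  have "J < \<infinity>"
    using unit_hardy_ball[OF f \<rho>] by (simp add: J_def order_le_less_trans)
  then obtain j where j: "J = ennreal j" "j \<ge> 0"
    by (cases J) auto
  have "ball z \<rho> \<subseteq> ball 0 1"
    using \<rho> by (intro ball_subset_ball_iff[THEN iffD2]) (simp add: dist_norm)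
  then have fz: "f holomorphic_on ball z \<rho>"
    using f by (auto simp: unit_hardy_def intro: holomorphic_on_subset)
  \<comment> \<open>This is J / (pi * (\<rho> / 2)^2), the bound given by the sub-mean value
    property on discs of radius \<rho> / 2.\<close>
  define Q where "Q = 4 * j / (pi * \<rho>\<^sup>2)"
  have "Q \<ge> 0"
    using j by (simp add: Q_def)
  have bound: "norm (f x) \<le> Q powr (1 / p)" if x: "norm (z - x) = \<rho> / 2" for x
  proof -
    have sub: "ball x (\<rho> / 2) \<subseteq> ball z \<rho>"
      using x \<rho> by (intro ball_subset_ball_iff[THEN iffD2]) (simp add: dist_norm norm_minus_commute)
    have "ennreal (pi * (\<rho> / 2)\<^sup>2 * norm (f x) powr p)
        \<le> (\<integral>\<^sup>+ w \<in> ball x (\<rho> / 2). ennreal (norm (f w) powr p) \<partial>lborel)"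
      using fz sub \<rho> p by (intro ball_submean_powr) (auto intro: holomorphic_on_subset)
    also have "\<dots> \<le> J"
      unfolding J_def using sub by (intro nn_integral_mono mult_left_mono indicator_leI) auto
    finally have "pi * (\<rho> / 2)\<^sup>2 * norm (f x) powr p \<le> j"
      using j by simp
    then have "norm (f x) powr p \<le> Q"
      using \<rho> by (simp add: Q_def field_simps)
    then have "(norm (f x) powr p) powr (1 / p) \<le> Q powr (1 / p)"
      using p by (intro powr_mono2) auto
    then show ?thesis
      using p by (simp add: powr_powr)
  qed
  have "norm ((deriv ^^ 1) f z) \<le> fact 1 * Q powr (1 / p) / (\<rho> / 2) ^ 1"
  proof (rule Cauchy_inequality)
    show "f holomorphic_on ball z (\<rho> / 2)"
      using fz \<rho> by (auto intro: holomorphic_on_subset)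
    have "cball z (\<rho> / 2) \<subseteq> ball z \<rho>"
      using \<rho> by auto
    then show "continuous_on (cball z (\<rho> / 2)) f"
      using fz by (blast intro: holomorphic_on_imp_continuous_on holomorphic_on_subset)
  qed (use \<rho> bound in auto)
  then have "norm (deriv f z) \<le> (2 / \<rho>) * Q powr (1 / p)"
    by (simp add: field_simps)
  then have "norm (deriv f z) powr p \<le> ((2 / \<rho>) * Q powr (1 / p)) powr p"
    using p by (intro powr_mono2) auto
  also have "\<dots> = (2 / \<rho>) powr p * Q"
    using p \<rho> \<open>Q \<ge> 0\<close> by (subst powr_mult) (simp_all add: powr_powr)
  also have "\<dots> = (2 / \<rho>) powr p * 4 / (pi * \<rho>\<^sup>2) * j"
    by (simp add: Q_def)
  finally have "ennreal (norm (deriv f z) powr p) \<le> ennreal ((2 / \<rho>) powr p * 4 / (pi * \<rho>\<^sup>2) * j)"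
    by (rule ennreal_leI)
  also have "\<dots> = ennreal ((2 / \<rho>) powr p * 4 / (pi * \<rho>\<^sup>2)) * J"
    unfolding j(1) using j(2) by (rule ennreal_mult'')
  finally show ?thesis
    by (simp add: J_def)
qed

lemma emeasure_ball_complex:
  "\<rho> \<ge> 0 \<Longrightarrow> emeasure lborel (ball (w :: complex) \<rho>) = ennreal (pi * \<rho>\<^sup>2)"
  by (simp add: emeasure_ball unit_ball_vol_2)

lemma borel_annulus [measurable]: "{z :: complex. a \<le> norm z \<and> norm z < b} \<in> sets borel"
proof -
  have "{z :: complex. a \<le> norm z \<and> norm z < b} = {z. a \<le> norm z} \<inter> {z. norm z < b}"
    by auto
  also have "\<dots> \<in> sets borel"
    by (intro sets.Int borel_open borel_closed open_Collect_less closed_Collect_le continuous_intros)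
  finally show ?thesis .
qed

text \<open>Integrate the pointwise estimate and exchange the integrals: each point w of the annulus
  thickened by \<rho> is met by a set of points z of area at most pi * \<rho>^2, which cancels the
  \<rho>^2 in the denominator of \<open>K\<close>.\<close>

lemma unit_hardy_deriv_annulus:
  assumes f: "unit_hardy p f" and p: "p > 1" and ab: "a \<le> b" and \<rho>: "\<rho> > 0" "b + \<rho> \<le> 1"
  shows "(\<integral>\<^sup>+ z \<in> {z. a \<le> norm z \<and> norm z < b}. ennreal (norm (deriv f z) powr p) \<partial>lborel)
    \<le> ennreal ((2 / \<rho>) powr p * 8 * pi * (b - a + 2 * \<rho>))"
proof -
  define A where "A = {z :: complex. a \<le> norm z \<and> norm z < b}"
  define A' where "A' = {z :: complex. a - \<rho> \<le> norm z \<and> norm z < b + \<rho>}"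
  define K where "K = (2 / \<rho>) powr p * 4 / (pi * \<rho>\<^sup>2)"
  have "K \<ge> 0"
    using \<rho> by (simp add: K_def)
  define h where "h w = ennreal (norm (f w) powr p) * indicator (ball 0 1) w" for w
  have [measurable]: "h \<in> borel_measurable borel"
    unfolding h_def using f
    by (intro borel_measurable_norm_powr_holomorphic[where G = "ball 0 1"]) (auto simp: unit_hardy_def)
  have [measurable]: "A \<in> sets borel" "A' \<in> sets borel"
    unfolding A_def A'_def by measurable
  \<comment> \<open>The last factor is the indicator of |z - w| < \<rho>, written through a Borel
    function of the pair to make joint measurability visible.\<close>
  define g :: "complex \<Rightarrow> complex \<Rightarrow> ennreal"
    where "g z w = indicator A z * (h w * indicator {0<..} (\<rho> - norm (z - w)))" for z w
  have [measurable]: "case_prod g \<in> borel_measurable (lborel \<Otimes>\<^sub>M lborel)"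
    unfolding g_def by measurable
  have "(\<integral>\<^sup>+ z \<in> A. ennreal (norm (deriv f z) powr p) \<partial>lborel)
      \<le> (\<integral>\<^sup>+ z. ennreal K * (\<integral>\<^sup>+ w. g z w \<partial>lborel) \<partial>lborel)"
  proof (intro nn_integral_mono)
    fix z
    show "ennreal (norm (deriv f z) powr p) * indicator A z \<le> ennreal K * (\<integral>\<^sup>+ w. g z w \<partial>lborel)"
    proof (cases "z \<in> A")
      case True
      then have z: "norm z + \<rho> \<le> 1"
        using \<rho> by (simp add: A_def)
      have "ball z \<rho> \<subseteq> ball 0 1"
        using z \<rho> by (intro ball_subset_ball_iff[THEN iffD2]) (simp add: dist_norm)
      then have "ennreal (norm (f w) powr p) * indicator (ball z \<rho>) w = g z w" for w
        using True by (auto simp: g_def h_def indicator_def dist_norm)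
      then show ?thesis
        using deriv_powr_le_nn_integral_ball[OF f p \<rho>(1) z] True by (simp add: K_def)
    qed simp
  qed
  also have "\<dots> = ennreal K * (\<integral>\<^sup>+ z. (\<integral>\<^sup>+ w. g z w \<partial>lborel) \<partial>lborel)"
    by (intro nn_integral_cmult) measurable
  also have "(\<integral>\<^sup>+ z. (\<integral>\<^sup>+ w. g z w \<partial>lborel) \<partial>lborel) = (\<integral>\<^sup>+ w. (\<integral>\<^sup>+ z. g z w \<partial>lborel) \<partial>lborel)"
    by (rule lborel_pair.Fubini'[symmetric]) measurable
  also have "\<dots> \<le> (\<integral>\<^sup>+ w. (ennreal (norm (f w) powr p) * indicator A' w) * ennreal (pi * \<rho>\<^sup>2) \<partial>lborel)"
  proof (intro nn_integral_mono)
    fix w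
    have "(\<integral>\<^sup>+ z. g z w \<partial>lborel)
        \<le> (\<integral>\<^sup>+ z. (ennreal (norm (f w) powr p) * indicator A' w) * indicator (ball w \<rho>) z \<partial>lborel)"
    proof (intro nn_integral_mono)
      fix z
      have "w \<in> A'" if "z \<in> A" "norm (z - w) < \<rho>"
      proof -
        have "\<bar>norm z - norm w\<bar> < \<rho>"
          using that(2) norm_triangle_ineq3[of z w] by linarith
        then show ?thesis
          using that(1) by (auto simp: A_def A'_def)
      qed
      then show "g z w \<le> (ennreal (norm (f w) powr p) * indicator A' w) * indicator (ball w \<rho>) z"
        by (auto simp: g_def h_def indicator_def dist_norm norm_minus_commute)
    qed
    also have "\<dots> = (ennreal (norm (f w) powr p) * indicator A' w) * ennreal (pi * \<rho>\<^sup>2)"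
      using \<rho> by (simp add: nn_integral_cmult_indicator emeasure_ball_complex)
    finally show "(\<integral>\<^sup>+ z. g z w \<partial>lborel) \<le> (ennreal (norm (f w) powr p) * indicator A' w) * ennreal (pi * \<rho>\<^sup>2)" .
  qed
  also have "\<dots> = (\<integral>\<^sup>+ w \<in> A'. ennreal (norm (f w) powr p) \<partial>lborel) * ennreal (pi * \<rho>\<^sup>2)"
  proof (intro nn_integral_multc)
    show "(\<lambda>w. ennreal (norm (f w) powr p) * indicator A' w) \<in> borel_measurable lborel"
      using f \<rho> borel_measurable_norm_powr_holomorphic[of f "ball 0 1" A' p] \<open>A' \<in> sets borel\<close>
      by (simp add: unit_hardy_def A'_def subset_iff)
  qed
  also have "\<dots> \<le> ennreal (2 * pi * ((b + \<rho>) - (a - \<rho>))) * ennreal (pi * \<rho>\<^sup>2)"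
    unfolding A'_def using f ab \<rho> by (intro mult_right_mono unit_hardy_annulus) auto
  also have "ennreal K * \<dots> = ennreal (K * (2 * pi * ((b + \<rho>) - (a - \<rho>)) * (pi * \<rho>\<^sup>2)))"
    using \<open>K \<ge> 0\<close> ab \<rho> by (simp add: ennreal_mult)
  also have "K * (2 * pi * ((b + \<rho>) - (a - \<rho>)) * (pi * \<rho>\<^sup>2)) = (2 / \<rho>) powr p * 8 * pi * (b - a + 2 * \<rho>)"
    using \<rho> by (simp add: K_def field_simps power2_eq_square)
  finally show ?thesis
    using mult_left_mono unfolding A_def by (simp add: mult_left_mono)
qed

section \<open>Dyadic annuli\<close>

definition dyadic_annulus :: "nat \<Rightarrow> complex set" where
  "dyadic_annulus k = {z. 1 - (1 / 2) ^ k \<le> norm z \<and> norm z < 1 - (1 / 2) ^ Suc k}"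

lemma borel_dyadic_annulus [measurable]: "dyadic_annulus k \<in> sets borel"
  unfolding dyadic_annulus_def by measurable

lemma norm_dyadic_annulus_less_1: "z \<in> dyadic_annulus k \<Longrightarrow> norm z < 1"
proof -
  assume "z \<in> dyadic_annulus k"
  then have "norm z < 1 - (1 / 2) ^ Suc k"
    by (simp add: dyadic_annulus_def)
  moreover have "(1 / 2 :: real) ^ Suc k > 0"
    by simp
  ultimately show "norm z < 1"
    by linarith
qed

lemma UN_dyadic_annulus: "(\<Union>k. dyadic_annulus k) = ball 0 1"
proof (intro antisym subsetI)
  fix z :: complex assume "z \<in> ball 0 1"
  then have z: "norm z < 1" by simp
  then obtain k0 where k0: "(1 / 2 :: real) ^ k0 < 1 - norm z"
    using real_arch_pow_inv[of "1 - norm z" "1/2"] by auto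
  define k where "k = (LEAST k. (1 / 2 :: real) ^ Suc k < 1 - norm z)"
  have "(1 / 2 :: real) ^ Suc k0 < 1 - norm z"
    using k0 z by simp
  then have k: "(1 / 2 :: real) ^ Suc k < 1 - norm z"
    unfolding k_def by (rule LeastI)
  have "1 - norm z \<le> (1 / 2 :: real) ^ k"
  proof (cases k)
    case (Suc j)
    then have "\<not> (1 / 2 :: real) ^ Suc j < 1 - norm z"
      using not_less_Least[of j "\<lambda>k. (1 / 2 :: real) ^ Suc k < 1 - norm z"] by (simp add: k_def)
    then show ?thesis
      using Suc by simp
  qed simp
  with k have "z \<in> dyadic_annulus k"
    by (simp add: dyadic_annulus_def)
  then show "z \<in> (\<Union>k. dyadic_annulus k)"
    by blast
qed (auto dest: norm_dyadic_annulus_less_1)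

lemma disjoint_dyadic_annulus: "disjoint_family dyadic_annulus"
proof -
  have "dyadic_annulus i \<inter> dyadic_annulus j = {}" if "i < j" for i j
  proof -
    have "(1 / 2 :: real) ^ j \<le> (1 / 2) ^ Suc i"
      using that by (intro power_decreasing) auto
    then show ?thesis
      by (auto simp: dyadic_annulus_def)
  qed
  then have "dyadic_annulus i \<inter> dyadic_annulus j = {}" if "i \<noteq> j" for i j
    using that by (metis Int_commute nat_neq_iff)
  then show ?thesis
    by (auto simp: disjoint_family_on_def)
qed

lemma powr_le_of_mem_Icc_half_2:
  fixes u \<beta> :: real
  assumes "1 / 2 \<le> u" "u \<le> 2"
  shows "u powr \<beta> \<le> 2 powr \<bar>\<beta>\<bar>"
proof (cases "\<beta> \<ge> 0")
  case True
  then show ?thesis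
    using assms by (auto intro: powr_mono2)
next
  case False
  then have "u powr \<beta> \<le> (1 / 2) powr \<beta>"
    using assms by (intro powr_mono2') auto
  also have "\<dots> = 2 powr \<bar>\<beta>\<bar>"
    using False by (simp add: powr_divide powr_minus_divide)
  finally show ?thesis .
qed

text \<open>On the annulus 1 - |z|^2 lies between d / 2 and 2 * d. The absolute value in the
  constant covers both signs of the exponent.\<close>

lemma weight_dyadic_annulus:
  assumes z: "z \<in> dyadic_annulus k"
  shows "(1 - (norm z)\<^sup>2) powr \<beta> \<le> 2 powr \<bar>\<beta>\<bar> * ((1 / 2) ^ k) powr \<beta>"
proof -
  define d :: real where "d = (1 / 2) ^ k"
  have d: "d > 0" "1 - norm z \<le> d" "d / 2 \<le> 1 - norm z"
    using z by (auto simp: d_def dyadic_annulus_def)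
  have eq: "1 - (norm z)\<^sup>2 = (1 - norm z) * (1 + norm z)"
    by (simp add: algebra_simps power2_eq_square)
  have z1: "norm z < 1"
    using norm_dyadic_annulus_less_1[OF z] .
  define u where "u = (1 - (norm z)\<^sup>2) / d"
  have "(1 - norm z) * 1 \<le> 1 - (norm z)\<^sup>2" "1 - (norm z)\<^sup>2 \<le> (1 - norm z) * 2"
    unfolding eq using z1 by (intro mult_left_mono; simp)+
  then have u: "1 / 2 \<le> u" "u \<le> 2"
    using d by (auto simp: u_def field_simps)
  have "(1 - (norm z)\<^sup>2) powr \<beta> = (u * d) powr \<beta>"
    using d by (simp add: u_def)
  also have "\<dots> = u powr \<beta> * d powr \<beta>"
    by (rule powr_mult)
  also have "\<dots> \<le> 2 powr \<bar>\<beta>\<bar> * d powr \<beta>"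
    using powr_le_of_mem_Icc_half_2[OF u] by (intro mult_right_mono) auto
  finally show ?thesis
    by (simp add: d_def)
qed

lemma borel_measurable_deriv_powr:
  assumes "f holomorphic_on ball 0 1"
  shows "(\<lambda>z. ennreal (norm (deriv f z) powr s) * indicator (dyadic_annulus k) z) \<in> borel_measurable borel"
  using assms
  by (intro borel_measurable_norm_powr_holomorphic[where G = "ball 0 1"] holomorphic_deriv)
    (auto dest: norm_dyadic_annulus_less_1)

lemma unit_hardy_dyadic_annulus:
  assumes "unit_hardy p f"
  shows "(\<integral>\<^sup>+ z \<in> dyadic_annulus k. ennreal (norm (f z) powr p) \<partial>lborel) \<le> ennreal (pi * (1 / 2) ^ k)"
proof -
  have "(\<integral>\<^sup>+ z \<in> dyadic_annulus k. ennreal (norm (f z) powr p) \<partial>lborel)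
     \<le> ennreal (2 * pi * ((1 - (1 / 2) ^ Suc k) - (1 - (1 / 2) ^ k)))"
    unfolding dyadic_annulus_def by (intro unit_hardy_annulus assms) auto
  also have "2 * pi * ((1 - (1 / 2) ^ Suc k) - (1 - (1 / 2) ^ k)) = pi * (1 / 2) ^ k"
    by simp
  finally show ?thesis .
qed

lemma emeasure_dyadic_annulus_le: "emeasure lborel (dyadic_annulus k) \<le> ennreal (pi * (1 / 2) ^ k)"
  using unit_hardy_dyadic_annulus[OF unit_hardy_one, of 1 k] by simp

section \<open>The Hardy bound on one annulus\<close>

text \<open>Lowers the exponent from p to s by comparison with a threshold D: up to D the constant
  dominates, and beyond it x powr (s - p) is at most its value at D.\<close>

lemma powr_le_split:
  fixes x D s p :: real
  assumes "x \<ge> 0" "D > 0" "0 < s" "s \<le> p"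
  shows "x powr s \<le> D powr s + D powr (s - p) * x powr p"
proof (cases "x \<le> D")
  case True
  then have "x powr s \<le> D powr s"
    using assms by (intro powr_mono2) auto
  then show ?thesis
    using assms by (simp add: add_increasing2)
next
  case False
  then have "x powr s = x powr (s - p) * x powr p"
    using assms by (simp flip: powr_add)
  also have "\<dots> \<le> D powr (s - p) * x powr p"
    using False assms by (intro mult_right_mono powr_mono2') auto
  finally show ?thesis
    using assms by (simp add: add_increasing)
qed

lemma deriv_powr_dyadic_annulus_hardy:
  assumes f: "unit_hardy p f" and p: "p > 1" and s: "0 < s" "s \<le> p"
  shows "(\<integral>\<^sup>+ z \<in> dyadic_annulus k. ennreal (norm (deriv f z) powr s) \<partial>lborel)
    \<le> ennreal ((pi + 12 * pi * 4 powr p) * ((1 / 2) ^ k) powr (1 - s))"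
proof -
  define d :: real where "d = (1 / 2) ^ k"
  have d: "d > 0" by (simp add: d_def)
  have holo: "f holomorphic_on ball 0 1"
    using f by (simp add: unit_hardy_def)
  note [measurable] = borel_measurable_deriv_powr[OF holo]
  have main: "(\<integral>\<^sup>+ z \<in> dyadic_annulus k. ennreal (norm (deriv f z) powr p) \<partial>lborel)
      \<le> ennreal (12 * pi * 4 powr p * d powr (1 - p))"
  proof -
    \<comment> \<open>A thickening by d / 2 is the largest that keeps the annulus inside the unit
      disc.\<close>
    have "(\<integral>\<^sup>+ z \<in> dyadic_annulus k. ennreal (norm (deriv f z) powr p) \<partial>lborel)
      \<le> ennreal ((2 / (d / 2)) powr p * 8 * pi * ((1 - d / 2) - (1 - d) + 2 * (d / 2)))"
      unfolding dyadic_annulus_def using unit_hardy_deriv_annulus[OF f p, of "1 - d" "1 - d / 2" "d / 2"] d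
      by (simp add: d_def)
    also have "(2 / (d / 2)) powr p * 8 * pi * ((1 - d / 2) - (1 - d) + 2 * (d / 2))
        = 12 * pi * ((4 / d) powr p * d)"
      by (simp add: field_simps)
    also have "(4 / d) powr p * d = 4 powr p * d powr (1 - p)"
      using d by (simp add: powr_divide powr_diff)
    finally show ?thesis
      by (simp add: mult.assoc)
  qed
  \<comment> \<open>With this threshold both terms of the split are of order d powr (1 - s).\<close>
  define D where "D = 1 / d"
  have D: "D > 0"
    using d by (simp add: D_def)
  have "(\<integral>\<^sup>+ z \<in> dyadic_annulus k. ennreal (norm (deriv f z) powr s) \<partial>lborel)
      \<le> (\<integral>\<^sup>+ z. ennreal (D powr s) * indicator (dyadic_annulus k) z
          + ennreal (D powr (s - p)) * (ennreal (norm (deriv f z) powr p) * indicator (dyadic_annulus k) z) \<partial>lborel)"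
  proof (intro nn_integral_mono)
    fix z
    have "ennreal (norm (deriv f z) powr s) \<le> ennreal (D powr s + D powr (s - p) * norm (deriv f z) powr p)"
      using D s by (intro ennreal_leI powr_le_split) auto
    also have "\<dots> = ennreal (D powr s) + ennreal (D powr (s - p)) * ennreal (norm (deriv f z) powr p)"
      by (simp add: ennreal_mult)
    finally show "ennreal (norm (deriv f z) powr s) * indicator (dyadic_annulus k) z
       \<le> ennreal (D powr s) * indicator (dyadic_annulus k) z
          + ennreal (D powr (s - p)) * (ennreal (norm (deriv f z) powr p) * indicator (dyadic_annulus k) z)"
      by (auto simp: indicator_def)
  qed
  also have "\<dots> = ennreal (D powr s) * emeasure lborel (dyadic_annulus k)
      + ennreal (D powr (s - p)) * (\<integral>\<^sup>+ z \<in> dyadic_annulus k. ennreal (norm (deriv f z) powr p) \<partial>lborel)"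
    by (subst nn_integral_add) (auto simp: nn_integral_cmult nn_integral_cmult_indicator)
  also have "\<dots> \<le> ennreal (D powr s) * ennreal (pi * d)
      + ennreal (D powr (s - p)) * ennreal (12 * pi * 4 powr p * d powr (1 - p))"
    using emeasure_dyadic_annulus_le[of k] main by (intro add_mono mult_left_mono) (auto simp: d_def)
  also have "\<dots> = ennreal (pi * (D powr s * d) + 12 * pi * 4 powr p * (D powr (s - p) * d powr (1 - p)))"
    using d by (simp add: mult_ac flip: ennreal_mult ennreal_plus)
  also have "D powr s * d = d powr (1 - s)"
    using d by (simp add: D_def powr_divide powr_diff)
  also have "D powr (s - p) * d powr (1 - p) = d powr (1 - s)"
  proof -
    have "D powr (s - p) = d powr (p - s)"
      using d by (simp add: D_def powr_divide powr_diff)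
    then show ?thesis
      by (simp flip: powr_add)
  qed
  also have "pi * d powr (1 - s) + 12 * pi * 4 powr p * d powr (1 - s) = (pi + 12 * pi * 4 powr p) * d powr (1 - s)"
    by (simp add: algebra_simps)
  finally show ?thesis
    by (simp add: d_def)
qed

section \<open>The area bound on one annulus\<close>

text \<open>For x > 0 the left-hand side is the geometric mean of the two terms on the right with
  weights s / 2 and 1 - s / 2, hence at most the larger of them. This pointwise Young inequality
  does the work of Hoelder's.\<close>

lemma powr_le_mult_add_powr:
  fixes x y s :: real
  assumes x: "x \<ge> 0" and y: "y > 0" and s: "0 < s" "s < 2"
  shows "x powr s \<le> x\<^sup>2 * y + y powr (- s / (2 - s))"
proof (cases "x powr s \<le> x\<^sup>2 * y")
  case True
  then show ?thesis
    by (simp add: add_increasing2)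
next
  case False
  then have x0: "x > 0"
    using x s by (cases "x = 0") auto
  have "x powr s * x powr (2 - s) = x\<^sup>2"
    using x0 by (simp flip: powr_add)
  then have "x powr s * (x powr (2 - s) * y) < x powr s * 1"
    using False by (simp add: mult.assoc[symmetric])
  then have "x powr (2 - s) * y < 1"
    using x0 by (simp add: mult_less_cancel_left_pos)
  then have "x powr (2 - s) \<le> 1 / y"
    using y by (simp add: field_simps)
  then have "(x powr (2 - s)) powr (s / (2 - s)) \<le> (1 / y) powr (s / (2 - s))"
    using s by (intro powr_mono2) auto
  then have "x powr s \<le> (1 / y) powr (s / (2 - s))"
    using s by (simp add: powr_powr)
  also have "\<dots> = y powr (- s / (2 - s))"
    using y by (simp add: powr_divide powr_minus_divide)
  finally show ?thesis
    using x0 y by (simp add: add_increasing)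
qed

lemma unit_hardy_growth_dyadic:
  assumes f: "unit_hardy p f" and p: "p > 1" and z: "z \<in> dyadic_annulus k"
  shows "norm (f z) < (9 * 2 ^ k) powr (1 / p)"
proof -
  have z1: "norm z < 1"
    using norm_dyadic_annulus_less_1[OF z] .
  have "(1 / 2) ^ Suc k \<le> 1 - norm z"
    using z by (simp add: dyadic_annulus_def)
  then have "4 / (1 - norm z) \<le> 4 / (1 / 2) ^ Suc k"
    by (intro divide_left_mono) (use z1 in auto)
  also have "\<dots> = 8 * 2 ^ k"
    by (simp add: power_divide)
  \<comment> \<open>Passing from 8 to 9 makes the bound strict, so that the whole annulus lies below
    the top level j = k.\<close>
  also have "\<dots> < (9 :: real) * 2 ^ k"
    by simp
  finally have "norm (f z) powr p < 9 * 2 ^ k"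
    using unit_hardy_growth[OF f z1 p] by simp
  then have "(norm (f z) powr p) powr (1 / p) < (9 * 2 ^ k) powr (1 / p)"
    using p by (intro powr_less_mono2) auto
  then show ?thesis
    using p by (simp add: powr_powr)
qed

text \<open>Slicing by the levels \<open>|f| < (9 * 2 ^ j) powr (1 / p)\<close>, \<open>j \<le> k\<close>, which are exactly the bounds for
  \<open>|f|\<close> on the dyadic annuli.\<close>

lemma level_sum_bound:
  fixes v p q :: real
  assumes p: "p > 1" and q: "q \<ge> 0" and v: "0 \<le> v" "v < (9 * 2 ^ k) powr (1 / p)"
  shows "max 1 v powr (- q)
    \<le> (\<Sum>j\<le>k. 2 powr (q / p) * 2 powr (- real j * q / p) * indicator {..<(9 * 2 ^ j) powr (1 / p)} v)"
proof -
  define M :: "nat \<Rightarrow> real" where "M j = (9 * 2 ^ j) powr (1 / p)" for j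
  define j where "j = (LEAST j. v < M j)"
  have Mk: "v < M k"
    using v(2) by (simp add: M_def)
  have vj: "v < M j"
    unfolding j_def using Mk by (rule LeastI)
  have jk: "j \<le> k"
    unfolding j_def using Mk by (rule Least_le)
  have "max 1 v powr (- q) \<le> 2 powr (q / p) * 2 powr (- real j * q / p)"
  proof (cases j)
    case 0
    have "max 1 v powr (- q) \<le> 1"
      using q powr_mono2'[of "- q" 1 "max 1 v"] by simp
    also have "1 \<le> (2 :: real) powr (q / p)"
      using p q by (intro ge_one_powr_ge_zero) auto
    finally show ?thesis
      using 0 by simp
  next
    \<comment> \<open>Minimality of j bounds \<open>v\<close> from below only by the preceding level
      i = j - 1; this shift costs the factor 2 powr (q / p).\<close>
    case (Suc i)
    then have "M i \<le> v"
      using not_less_Least[of i "\<lambda>j. v < M j"] by (simp add: j_def)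
    moreover have "(2 :: real) powr (real i / p) \<le> M i"
    proof -
      have "(2 :: real) powr (real i / p) = (2 ^ i) powr (1 / p)"
        using powr_powr[of 2 "real i" "1 / p"] by (simp add: powr_realpow)
      also have "\<dots> \<le> M i"
        unfolding M_def using p by (intro powr_mono2) auto
      finally show ?thesis .
    qed
    ultimately have "max 1 v powr (- q) \<le> (2 powr (real i / p)) powr (- q)"
      using q by (intro powr_mono2') auto
    also have "\<dots> = 2 powr (q / p) * 2 powr (- real j * q / p)"
      using Suc p by (simp add: powr_powr field_simps flip: powr_add)
    finally show ?thesis .
  qed
  also have "\<dots> = 2 powr (q / p) * 2 powr (- real j * q / p) * indicator {..<M j} v"
    using vj by simp
  also have "\<dots> \<le> (\<Sum>j\<le>k. 2 powr (q / p) * 2 powr (- real j * q / p) * indicator {..<M j} v)"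
    by (rule member_le_sum[of j "{..k}" "\<lambda>j. 2 powr (q / p) * 2 powr (- real j * q / p) * indicator {..<M j} v"])
      (use jk in auto)
  finally show ?thesis
    by (simp add: M_def)
qed

text \<open>The weight of level j is of order 2 powr (- j * q / p), and its area bound, n times the
  square of the level, of order n * 2 powr (2 * j / p). Their product is the summand.\<close>

lemma deriv_square_damped_dyadic_annulus:
  assumes f: "unit_hardy p f" and p: "p > 1" and q: "q \<ge> 0" and n: "n > 0"
    and area: "\<And>R. R > 0 \<Longrightarrow>
      (\<integral>\<^sup>+ z \<in> {z \<in> ball 0 1. norm (f z) < R}. ennreal ((norm (deriv f z))\<^sup>2) \<partial>lborel) \<le> ennreal (pi * n * R\<^sup>2)"
  shows "(\<integral>\<^sup>+ z \<in> dyadic_annulus k. ennreal ((norm (deriv f z))\<^sup>2 * max 1 (norm (f z)) powr (- q)) \<partial>lborel)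
    \<le> ennreal (pi * 9 powr (2 / p) * 2 powr (q / p) * (n * (\<Sum>j\<le>k. 2 powr (real j * (2 - q) / p))))"
proof -
  define M :: "nat \<Rightarrow> real" where "M j = (9 * 2 ^ j) powr (1 / p)" for j
  define c where "c j = 2 powr (q / p) * 2 powr (- real j * q / p)" for j
  define W where "W j = {z \<in> ball 0 1. norm (f z) < M j}" for j
  have holo: "f holomorphic_on ball 0 1"
    using f by (simp add: unit_hardy_def)
  have W_borel: "W j \<in> sets borel" for j
  proof -
    have "open (ball 0 1 \<inter> f -` ball 0 (M j))"
      using holo by (intro continuous_open_preimage holomorphic_on_imp_continuous_on) auto
    moreover have "ball 0 1 \<inter> f -` ball 0 (M j) = W j"
      by (auto simp: W_def)
    ultimately show ?thesis
      by simp
  qed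
  have meas: "(\<lambda>z. ennreal ((norm (deriv f z))\<^sup>2) * indicator (W j) z) \<in> borel_measurable borel" for j
  proof -
    have "(\<lambda>z. ennreal (norm (deriv f z) powr 2) * indicator (W j) z) \<in> borel_measurable borel"
      by (rule borel_measurable_norm_powr_holomorphic[OF holomorphic_deriv[OF holo] _ W_borel])
        (auto simp: W_def)
    then show ?thesis
      by simp
  qed
  have "(\<integral>\<^sup>+ z \<in> dyadic_annulus k. ennreal ((norm (deriv f z))\<^sup>2 * max 1 (norm (f z)) powr (- q)) \<partial>lborel)
      \<le> (\<integral>\<^sup>+ z. (\<Sum>j\<le>k. ennreal (c j) * (ennreal ((norm (deriv f z))\<^sup>2) * indicator (W j) z)) \<partial>lborel)"
  proof (intro nn_integral_mono)
    fix z
    show "ennreal ((norm (deriv f z))\<^sup>2 * max 1 (norm (f z)) powr (- q)) * indicator (dyadic_annulus k) z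
      \<le> (\<Sum>j\<le>k. ennreal (c j) * (ennreal ((norm (deriv f z))\<^sup>2) * indicator (W j) z))"
    proof (cases "z \<in> dyadic_annulus k")
      case True
      then have z1: "norm z < 1"
        by (rule norm_dyadic_annulus_less_1)
      have "max 1 (norm (f z)) powr (- q) \<le> (\<Sum>j\<le>k. c j * indicator {..<M j} (norm (f z)))"
        unfolding c_def M_def using unit_hardy_growth_dyadic[OF f p True] p q by (intro level_sum_bound) auto
      then have "(norm (deriv f z))\<^sup>2 * max 1 (norm (f z)) powr (- q)
          \<le> (norm (deriv f z))\<^sup>2 * (\<Sum>j\<le>k. c j * indicator {..<M j} (norm (f z)))"
        by (intro mult_left_mono) auto
      also have "\<dots> = (\<Sum>j\<le>k. c j * ((norm (deriv f z))\<^sup>2 * indicator (W j) z))"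
        using z1 unfolding sum_distrib_left by (intro sum.cong) (auto simp: W_def indicator_def)
      finally have "ennreal ((norm (deriv f z))\<^sup>2 * max 1 (norm (f z)) powr (- q))
          \<le> ennreal (\<Sum>j\<le>k. c j * ((norm (deriv f z))\<^sup>2 * indicator (W j) z))"
        by (rule ennreal_leI)
      also have "\<dots> = (\<Sum>j\<le>k. ennreal (c j * ((norm (deriv f z))\<^sup>2 * indicator (W j) z)))"
        by (rule sum_ennreal[symmetric]) (simp add: c_def)
      also have "\<dots> = (\<Sum>j\<le>k. ennreal (c j) * (ennreal ((norm (deriv f z))\<^sup>2) * indicator (W j) z))"
        by (intro sum.cong refl) (auto simp: c_def ennreal_mult indicator_def)
      finally show ?thesis
        using True by simp
    qed simp
  qed
  also have "\<dots> = (\<Sum>j\<le>k. ennreal (c j) * (\<integral>\<^sup>+ z \<in> W j. ennreal ((norm (deriv f z))\<^sup>2) \<partial>lborel))"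
    using meas by (subst nn_integral_sum) (auto simp: nn_integral_cmult)
  also have "\<dots> \<le> (\<Sum>j\<le>k. ennreal (c j) * ennreal (pi * n * (M j)\<^sup>2))"
    unfolding W_def by (intro sum_mono mult_left_mono area) (auto simp: M_def)
  also have "\<dots> = (\<Sum>j\<le>k. ennreal (c j * (pi * n * (M j)\<^sup>2)))"
    using n by (intro sum.cong refl ennreal_mult[symmetric]) (auto simp: c_def)
  also have "\<dots> = ennreal (\<Sum>j\<le>k. c j * (pi * n * (M j)\<^sup>2))"
    using n by (intro sum_ennreal) (auto simp: c_def)
  also have "(\<Sum>j\<le>k. c j * (pi * n * (M j)\<^sup>2))
      = (\<Sum>j\<le>k. pi * 9 powr (2 / p) * 2 powr (q / p) * (n * 2 powr (real j * (2 - q) / p)))"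
  proof (intro sum.cong refl)
    fix j
    have "(M j)\<^sup>2 = M j powr 2"
      by (simp add: M_def)
    also have "\<dots> = 9 powr (2 / p) * (2 powr real j) powr (2 / p)"
      unfolding M_def by (simp add: powr_powr powr_mult powr_realpow)
    also have "(2 powr real j) powr (2 / p) = (2 :: real) powr (real j * 2 / p)"
      by (simp add: powr_powr)
    finally have M2: "(M j)\<^sup>2 = 9 powr (2 / p) * 2 powr (real j * 2 / p)" .
    have "(2 :: real) powr (- real j * q / p) * 2 powr (real j * 2 / p) = 2 powr (real j * (2 - q) / p)"
      using p by (simp add: field_simps flip: powr_add)
    then show "c j * (pi * n * (M j)\<^sup>2)
        = pi * 9 powr (2 / p) * 2 powr (q / p) * (n * 2 powr (real j * (2 - q) / p))"
      unfolding M2 c_def by (simp add: mult_ac)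
  qed
  finally show ?thesis
    by (simp add: sum_distrib_left)
qed

text \<open>Young's inequality with y = \<open>A * \<phi> z\<close>. The damping that controls the
  first term returns in the second as max 1 |f| powr (q * s / (2 - s)), which the condition on q
  bounds by 1 + |f| powr p. Optimising the free constant \<open>A\<close> reproduces the Hoelder
  exponents s / 2 and 1 - s / 2.\<close>

lemma deriv_powr_dyadic_annulus_area:
  assumes f: "unit_hardy p f" and p: "p > 1" and s: "0 < s" "s < 2"
    and q: "q \<ge> 0" "q * s / (2 - s) \<le> p" and n: "n > 0"
    and area: "\<And>R. R > 0 \<Longrightarrow>
      (\<integral>\<^sup>+ z \<in> {z \<in> ball 0 1. norm (f z) < R}. ennreal ((norm (deriv f z))\<^sup>2) \<partial>lborel) \<le> ennreal (pi * n * R\<^sup>2)"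
  shows "(\<integral>\<^sup>+ z \<in> dyadic_annulus k. ennreal (norm (deriv f z) powr s) \<partial>lborel)
    \<le> ennreal ((pi * 9 powr (2 / p) * 2 powr (q / p) + 2 * pi)
        * (n * (\<Sum>j\<le>k. 2 powr (real j * (2 - q) / p))) powr (s / 2) * ((1 / 2) ^ k) powr (1 - s / 2))"
proof -
  define d :: real where "d = (1 / 2) ^ k"
  have d: "d > 0" by (simp add: d_def)
  define X where "X = n * (\<Sum>j\<le>k. 2 powr (real j * (2 - q) / p))"
  have "(\<Sum>j\<le>k. 2 powr (real j * (2 - q) / p)) > 0"
    by (intro sum_pos) auto
  then have X: "X > 0"
    using n by (simp add: X_def)
  define C where "C = pi * 9 powr (2 / p) * 2 powr (q / p)"
  have C: "C \<ge> 0" by (simp add: C_def)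
  \<comment> \<open>The weight in Young's inequality, chosen so that both resulting terms are of equal size.\<close>
  define A where "A = (d / X) powr ((2 - s) / 2)"
  have A: "A > 0" using d X by (simp add: A_def)
  define A' where "A' = A powr (- s / (2 - s))"
  have split: "ennreal (A * u + A' * (1 + v)) = ennreal A * ennreal u + (ennreal A' + ennreal A' * ennreal v)"
    if "u \<ge> 0" "v \<ge> 0" for u v
    using that A by (simp add: distrib_left ennreal_mult A'_def)
  have AX: "A * X = X powr (s / 2) * d powr (1 - s / 2)"
  proof -
    have "A * X = d powr (1 - s / 2) / X powr (1 - s / 2) * X powr 1"
      using d X by (simp add: A_def powr_divide diff_divide_distrib)
    also have "\<dots> = d powr (1 - s / 2) * X powr (1 - (1 - s / 2))"
      by (subst powr_diff) simp
    finally show ?thesis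
      by (simp add: mult.commute)
  qed
  have A'd: "A' * d = X powr (s / 2) * d powr (1 - s / 2)"
  proof -
    have "(2 - s) / 2 * (- s / (2 - s)) = - (s / 2)"
      using s by (simp add: divide_simps)
    then have "A' = (d / X) powr (- (s / 2))"
      by (simp only: A'_def A_def powr_powr)
    also have "\<dots> = (X / d) powr (s / 2)"
      using d X by (simp add: powr_minus powr_divide)
    also have "\<dots> * d = X powr (s / 2) * (d powr 1 / d powr (s / 2))"
      using d X by (simp add: powr_divide)
    finally show ?thesis
      by (simp add: powr_diff)
  qed
  have holo: "f holomorphic_on ball 0 1"
    using f by (simp add: unit_hardy_def)
  define \<phi> where "\<phi> z = max 1 (norm (f z)) powr (- q)" for z
  have \<phi>_pos: "\<phi> z > 0" for z
    by (simp add: \<phi>_def)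
  have [measurable]: "(\<lambda>z. ennreal (norm (f z) powr p) * indicator (dyadic_annulus k) z) \<in> borel_measurable borel"
    using holo by (intro borel_measurable_norm_powr_holomorphic[where G = "ball 0 1"]) (auto dest: norm_dyadic_annulus_less_1)
  have [measurable]: "(\<lambda>z. ennreal ((norm (deriv f z))\<^sup>2 * \<phi> z) * indicator (dyadic_annulus k) z) \<in> borel_measurable borel"
  proof -
    have [measurable]: "(\<lambda>z. indicator (ball 0 1) z *\<^sub>R f z) \<in> borel_measurable borel"
      "(\<lambda>z. indicator (ball 0 1) z *\<^sub>R deriv f z) \<in> borel_measurable borel"
      using holo by (intro borel_measurable_indicator_holomorphic holomorphic_deriv; simp)+
    have "(\<lambda>z. ennreal ((norm (indicator (ball 0 1) z *\<^sub>R deriv f z))\<^sup>2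
        * max 1 (norm (indicator (ball 0 1) z *\<^sub>R f z)) powr (- q)) * indicator (dyadic_annulus k) z) \<in> borel_measurable borel"
      by measurable
    moreover have "(\<lambda>z. ennreal ((norm (indicator (ball 0 1) z *\<^sub>R deriv f z))\<^sup>2
        * max 1 (norm (indicator (ball 0 1) z *\<^sub>R f z)) powr (- q)) * indicator (dyadic_annulus k) z)
      = (\<lambda>z. ennreal ((norm (deriv f z))\<^sup>2 * \<phi> z) * indicator (dyadic_annulus k) z)"
      by (auto simp: fun_eq_iff indicator_def \<phi>_def dest: norm_dyadic_annulus_less_1)
    ultimately show ?thesis
      by simp
  qed
  have young: "norm (deriv f z) powr s \<le> A * ((norm (deriv f z))\<^sup>2 * \<phi> z) + A' * (1 + norm (f z) powr p)" for z
  proof -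
    have "norm (deriv f z) powr s \<le> (norm (deriv f z))\<^sup>2 * (A * \<phi> z) + (A * \<phi> z) powr (- s / (2 - s))"
      using A \<phi>_pos s by (intro powr_le_mult_add_powr) auto
    also have "(A * \<phi> z) powr (- s / (2 - s)) = A' * max 1 (norm (f z)) powr (q * s / (2 - s))"
      using A \<phi>_pos[of z] by (simp add: powr_mult A'_def \<phi>_def powr_powr)
    also have "max 1 (norm (f z)) powr (q * s / (2 - s)) \<le> max 1 (norm (f z)) powr p"
      using q by (intro powr_mono) auto
    also have "max 1 (norm (f z)) powr p \<le> 1 + norm (f z) powr p"
      by (auto simp: max_def)
    finally show ?thesis
      using A by (simp add: A'_def mult_ac)
  qed
  have "(\<integral>\<^sup>+ z \<in> dyadic_annulus k. ennreal (norm (deriv f z) powr s) \<partial>lborel)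
      \<le> (\<integral>\<^sup>+ z. ennreal A * (ennreal ((norm (deriv f z))\<^sup>2 * \<phi> z) * indicator (dyadic_annulus k) z)
          + (ennreal A' * indicator (dyadic_annulus k) z
             + ennreal A' * (ennreal (norm (f z) powr p) * indicator (dyadic_annulus k) z)) \<partial>lborel)"
  proof (intro nn_integral_mono)
    fix z
    have "ennreal (norm (deriv f z) powr s)
        \<le> ennreal (A * ((norm (deriv f z))\<^sup>2 * \<phi> z) + A' * (1 + norm (f z) powr p))"
      by (intro ennreal_leI young)
    also have "\<dots> = ennreal A * ennreal ((norm (deriv f z))\<^sup>2 * \<phi> z)
        + (ennreal A' + ennreal A' * ennreal (norm (f z) powr p))"
      using \<phi>_pos[of z] by (intro split) (auto intro: less_imp_le)
    finally show "ennreal (norm (deriv f z) powr s) * indicator (dyadic_annulus k) z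
        \<le> ennreal A * (ennreal ((norm (deriv f z))\<^sup>2 * \<phi> z) * indicator (dyadic_annulus k) z)
          + (ennreal A' * indicator (dyadic_annulus k) z
             + ennreal A' * (ennreal (norm (f z) powr p) * indicator (dyadic_annulus k) z))"
      by (auto simp: indicator_def)
  qed
  also have "\<dots> = ennreal A * (\<integral>\<^sup>+ z \<in> dyadic_annulus k. ennreal ((norm (deriv f z))\<^sup>2 * \<phi> z) \<partial>lborel)
      + (ennreal A' * emeasure lborel (dyadic_annulus k)
        + ennreal A' * (\<integral>\<^sup>+ z \<in> dyadic_annulus k. ennreal (norm (f z) powr p) \<partial>lborel))"
    by (subst nn_integral_add, simp, simp, subst nn_integral_add, simp, simp)
      (simp add: nn_integral_cmult nn_integral_cmult_indicator)
  also have "\<dots> \<le> ennreal A * ennreal (C * X) + (ennreal A' * ennreal (pi * d) + ennreal A' * ennreal (pi * d))"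
    using deriv_square_damped_dyadic_annulus[OF f p q(1) n area, of k]
      emeasure_dyadic_annulus_le[of k] unit_hardy_dyadic_annulus[OF f, of k]
    by (intro add_mono mult_left_mono) (auto simp: d_def X_def C_def \<phi>_def)
  also have "\<dots> = ennreal (C * (A * X) + 2 * pi * (A' * d))"
  proof -
    have "A' \<ge> 0"
      by (simp add: A'_def)
    then have e: "ennreal A * ennreal (C * X) = ennreal (A * (C * X))"
      "ennreal A' * ennreal (pi * d) = ennreal (A' * (pi * d))"
      using A X C d by (auto intro!: ennreal_mult[symmetric])
    have "ennreal (A * (C * X)) + (ennreal (A' * (pi * d)) + ennreal (A' * (pi * d)))
        = ennreal (A * (C * X) + (A' * (pi * d) + A' * (pi * d)))"
      using A X C d \<open>A' \<ge> 0\<close> by (subst ennreal_plus, simp, simp, subst ennreal_plus, simp_all)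
    also have "A * (C * X) + (A' * (pi * d) + A' * (pi * d)) = C * (A * X) + 2 * pi * (A' * d)"
      by (simp add: algebra_simps)
    finally show ?thesis
      unfolding e .
  qed
  also have "C * (A * X) + 2 * pi * (A' * d) = (C + 2 * pi) * X powr (s / 2) * d powr (1 - s / 2)"
    unfolding AX A'd by (simp add: algebra_simps)
  finally show ?thesis
    by (simp add: C_def X_def d_def)
qed

section \<open>Summation\<close>

text \<open>The form in which mean valency is used. As R runs through all positive reals, the
  condition survives division of f by a positive constant with the same n.\<close>

definition area_valent :: "real \<Rightarrow> (complex \<Rightarrow> complex) \<Rightarrow> bool" where
  "area_valent n f \<longleftrightarrow> (\<forall>R>0.
      (\<integral>\<^sup>+ z \<in> {z \<in> ball 0 1. norm (f z) < R}. ennreal ((norm (deriv f z))\<^sup>2) \<partial>lborel) \<le> ennreal (pi * n * R\<^sup>2))"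

lemma besov_le_suminf_dyadic:
  assumes f: "f holomorphic_on ball 0 1"
    and X: "\<And>k. (\<integral>\<^sup>+ z \<in> dyadic_annulus k. ennreal (norm (deriv f z) powr s) \<partial>lborel) \<le> ennreal (X k)"
  shows "besov_seminorm_powr \<alpha> s f
    \<le> (\<Sum>k. ennreal (2 powr \<bar>(1 - \<alpha>) * s - 1\<bar> * ((1 / 2) ^ k) powr ((1 - \<alpha>) * s - 1) * X k))"
proof -
  define \<beta> where "\<beta> = (1 - \<alpha>) * s - 1"
  define h where "h k z = ennreal (norm (deriv f z) powr s * (1 - (norm z)\<^sup>2) powr \<beta>) * indicator (dyadic_annulus k) z" for k z
  have meas: "h k \<in> borel_measurable borel" for k
  proof -
    have [measurable]: "(\<lambda>z. ennreal (norm (deriv f z) powr s) * indicator (dyadic_annulus k) z) \<in> borel_measurable borel"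
      using borel_measurable_deriv_powr[OF f] .
    have "(\<lambda>z. (ennreal (norm (deriv f z) powr s) * indicator (dyadic_annulus k) z)
        * ennreal ((1 - (norm z)\<^sup>2) powr \<beta>)) \<in> borel_measurable borel"
      by measurable
    moreover have "(\<lambda>z. (ennreal (norm (deriv f z) powr s) * indicator (dyadic_annulus k) z)
        * ennreal ((1 - (norm z)\<^sup>2) powr \<beta>)) = h k"
      by (auto simp: h_def fun_eq_iff indicator_def ennreal_mult)
    ultimately show ?thesis
      by simp
  qed
  have "besov_seminorm_powr \<alpha> s f
      = (\<integral>\<^sup>+ z. ennreal (norm (deriv f z) powr s * (1 - (norm z)\<^sup>2) powr \<beta>) * indicator (\<Union>k. dyadic_annulus k) z \<partial>lborel)"
    by (simp add: besov_seminorm_powr_def \<beta>_def UN_dyadic_annulus)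
  also have "\<dots> = (\<integral>\<^sup>+ z. (\<Sum>k. h k z) \<partial>lborel)"
    unfolding h_def using suminf_indicator[OF disjoint_dyadic_annulus] by simp
  also have "\<dots> = (\<Sum>k. \<integral>\<^sup>+ z. h k z \<partial>lborel)"
    using meas by (intro nn_integral_suminf) simp
  also have "\<dots> \<le> (\<Sum>k. ennreal (2 powr \<bar>\<beta>\<bar> * ((1 / 2) ^ k) powr \<beta> * X k))"
  proof (intro suminf_le summableI)
    fix k
    define w where "w = 2 powr \<bar>\<beta>\<bar> * ((1 / 2) ^ k) powr \<beta>"
    have "w \<ge> 0"
      by (simp add: w_def)
    have "(\<integral>\<^sup>+ z. h k z \<partial>lborel)
        \<le> (\<integral>\<^sup>+ z. ennreal w * (ennreal (norm (deriv f z) powr s) * indicator (dyadic_annulus k) z) \<partial>lborel)"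
    proof (intro nn_integral_mono)
      fix z
      show "h k z \<le> ennreal w * (ennreal (norm (deriv f z) powr s) * indicator (dyadic_annulus k) z)"
      proof (cases "z \<in> dyadic_annulus k")
        case True
        then have "norm (deriv f z) powr s * (1 - (norm z)\<^sup>2) powr \<beta> \<le> norm (deriv f z) powr s * w"
          unfolding w_def by (intro mult_left_mono weight_dyadic_annulus) auto
        then have "ennreal (norm (deriv f z) powr s * (1 - (norm z)\<^sup>2) powr \<beta>) \<le> ennreal (norm (deriv f z) powr s * w)"
          by (rule ennreal_leI)
        also have "\<dots> = ennreal w * ennreal (norm (deriv f z) powr s)"
          using \<open>w \<ge> 0\<close> by (simp add: ennreal_mult mult.commute)
        finally show ?thesis
          using True by (simp add: h_def)
      qed (simp add: h_def)
    qed
    also have "\<dots> = ennreal w * (\<integral>\<^sup>+ z \<in> dyadic_annulus k. ennreal (norm (deriv f z) powr s) \<partial>lborel)"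
      using borel_measurable_deriv_powr[OF f] by (intro nn_integral_cmult) simp
    also have "\<dots> \<le> ennreal w * ennreal (X k)"
      by (intro mult_left_mono X) auto
    also have "\<dots> = ennreal (w * X k)"
      using \<open>w \<ge> 0\<close> by (rule ennreal_mult'[symmetric])
    finally show "(\<integral>\<^sup>+ z. h k z \<partial>lborel) \<le> ennreal (2 powr \<bar>\<beta>\<bar> * ((1 / 2) ^ k) powr \<beta> * X k)"
      by (simp add: w_def)
  qed
  finally show ?thesis
    by (simp add: \<beta>_def)
qed

lemma half_power_powr: "((1 / 2) ^ k) powr e = (2 powr (- e)) ^ k" for e :: real
proof -
  have "((1 / 2 :: real) ^ k) = 2 powr (- real k)"
    unfolding powr_minus powr_realpow[OF zero_less_numeral] by (simp add: power_one_over inverse_eq_divide)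
  then have "((1 / 2) ^ k) powr e = 2 powr (- e * real k)"
    by (simp add: powr_powr mult.commute)
  also have "\<dots> = (2 powr (- e)) powr real k"
    by (simp only: powr_powr)
  finally show ?thesis
    by (simp add: powr_realpow)
qed

text \<open>Here \<open>m\<close> separates the inner annuli, estimated by \<open>u\<close>, from
  the outer ones, estimated by the convergent series of \<open>v\<close>.\<close>

lemma suminf_ennreal_split_le:
  fixes x u v :: "nat \<Rightarrow> real"
  assumes x: "\<And>k. x k \<ge> 0" and u: "\<And>k. k < m \<Longrightarrow> x k \<le> u k"
    and v: "\<And>i. x (i + m) \<le> v i" "v sums V"
  shows "(\<Sum>k. ennreal (x k)) \<le> ennreal ((\<Sum>k<m. u k) + V)"
proof -
  have sum_tail: "summable (\<lambda>i. x (i + m))"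
    by (rule summable_comparison_test'[OF sums_summable[OF v(2)], of 0]) (use x v(1) in simp)
  then have summ: "summable x"
    by (simp add: summable_iff_shift)
  have "(\<Sum>k. x k) = (\<Sum>i. x (i + m)) + (\<Sum>k<m. x k)"
    using suminf_split_initial_segment[OF summ] .
  also have "\<dots> \<le> (\<Sum>i. v i) + (\<Sum>k<m. u k)"
    using u by (intro add_mono sum_mono suminf_le v(1) sum_tail sums_summable[OF v(2)]) auto
  also have "(\<Sum>i. v i) = V"
    using v(2) by (rule sums_unique[symmetric])
  finally show ?thesis
    using x summ by (subst suminf_ennreal2) (auto intro: ennreal_leI simp: add.commute)
qed

lemma sum_geometric_le:
  fixes g :: real
  assumes "g > 1"
  shows "(\<Sum>k\<le>m. g ^ k) \<le> g / (g - 1) * g ^ m"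
proof -
  have "(\<Sum>k\<le>m. g ^ k) = (g ^ Suc m - 1) / (g - 1)"
    using geometric_sum[of g "Suc m"] assms unfolding lessThan_Suc_atMost by simp
  also have "\<dots> \<le> g ^ Suc m / (g - 1)"
    using assms by (intro divide_right_mono) auto
  finally show ?thesis
    by simp
qed

text \<open>The index \<open>m\<close> is that of the last annulus with (1 / 2) ^ m \<ge> 1 /
  n.\<close>

lemma exists_dyadic_bracket:
  fixes n :: real
  assumes "n \<ge> 1"
  obtains m :: nat where "2 ^ m \<le> n" "n < 2 ^ Suc m"
proof -
  define m where "m = nat \<lfloor>log 2 n\<rfloor>"
  have "log 2 n \<ge> 0"
    using assms by simp
  then have "real m \<le> log 2 n" "log 2 n < real (Suc m)"
    unfolding m_def by linarith+
  then have "2 powr real m \<le> n" "n < 2 powr real (Suc m)"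
    using assms by (auto simp: le_log_iff log_less_iff)
  then show thesis
    using that[of m] by (simp add: powr_realpow del: of_nat_Suc power_Suc)
qed

text \<open>A single sequence, built from the minimum of the two annulus estimates, obeys both
  bounds, so the place of the cut can be chosen later. The weight d powr ((1 - \<alpha>) * s - 1)
  times d powr (1 - s) leaves d powr (- \<alpha> * s), and times d powr (1 - s / 2) it leaves d powr
  (s / 2 - \<alpha> * s); these are the two geometric factors.\<close>

lemma besov_dyadic_terms:
  assumes f: "unit_hardy p f" "area_valent n f" and p: "p > 1" and s: "0 < s" "s < 2" "s \<le> p"
    and q: "q \<ge> 0" "q * s / (2 - s) \<le> p" and n: "n > 0"
  obtains x :: "nat \<Rightarrow> real" where "besov_seminorm_powr \<alpha> s f \<le> (\<Sum>k. ennreal (x k))" "\<And>k. x k \<ge> 0"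
    "\<And>k. x k \<le> 2 powr \<bar>(1 - \<alpha>) * s - 1\<bar> * (pi + 12 * pi * 4 powr p) * (2 powr (\<alpha> * s)) ^ k"
    "\<And>k. x k \<le> 2 powr \<bar>(1 - \<alpha>) * s - 1\<bar> * (pi * 9 powr (2 / p) * 2 powr (q / p) + 2 * pi)
        * n powr (s / 2) * (\<Sum>j\<le>k. 2 powr (real j * (2 - q) / p)) powr (s / 2) * (2 powr (\<alpha> * s - s / 2)) ^ k"
proof -
  define W where "W = 2 powr \<bar>(1 - \<alpha>) * s - 1\<bar>"
  define \<beta> where "\<beta> = (1 - \<alpha>) * s - 1"
  define Ca where "Ca = pi + 12 * pi * 4 powr p"
  define Cb where "Cb = pi * 9 powr (2 / p) * 2 powr (q / p) + 2 * pi"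
  define S where "S k = (\<Sum>j\<le>k. 2 powr (real j * (2 - q) / p))" for k
  have S: "S k \<ge> 0" for k
    by (auto simp: S_def intro!: sum_nonneg)
  define d :: "nat \<Rightarrow> real" where "d k = (1 / 2) ^ k" for k
  define Xa where "Xa k = Ca * d k powr (1 - s)" for k
  define Xb where "Xb k = Cb * (n * S k) powr (s / 2) * d k powr (1 - s / 2)" for k
  define x where "x k = W * d k powr \<beta> * min (Xa k) (Xb k)" for k
  have a: "(\<integral>\<^sup>+ z \<in> dyadic_annulus k. ennreal (norm (deriv f z) powr s) \<partial>lborel) \<le> ennreal (Xa k)" for k
    using deriv_powr_dyadic_annulus_hardy[OF f(1) p s(1,3), of k] by (simp add: Xa_def Ca_def d_def)
  have b: "(\<integral>\<^sup>+ z \<in> dyadic_annulus k. ennreal (norm (deriv f z) powr s) \<partial>lborel) \<le> ennreal (Xb k)" for k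
    using deriv_powr_dyadic_annulus_area[OF f(1) p s(1,2) q n, of k] f(2)
    by (simp add: Xb_def Cb_def d_def S_def area_valent_def)
  have ab: "(\<integral>\<^sup>+ z \<in> dyadic_annulus k. ennreal (norm (deriv f z) powr s) \<partial>lborel) \<le> ennreal (min (Xa k) (Xb k))" for k
    using a[of k] b[of k] by (simp add: min_def)
  have W: "W \<ge> 0"
    by (simp add: W_def)
  have C: "Ca \<ge> 0" "Cb \<ge> 0"
    by (auto simp: Ca_def Cb_def)
  show thesis
  proof (rule that[of x])
    show "besov_seminorm_powr \<alpha> s f \<le> (\<Sum>k. ennreal (x k))"
      using besov_le_suminf_dyadic[OF _ ab, where \<alpha> = \<alpha>] f(1)
      by (simp add: unit_hardy_def x_def W_def \<beta>_def d_def)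
  next
    fix k
    have Wd: "W * d k powr \<beta> \<ge> 0"
      using W by simp
    have "min (Xa k) (Xb k) \<ge> 0"
      using C by (simp add: Xa_def Xb_def)
    then show "x k \<ge> 0"
      using Wd by (simp add: x_def)
    have "x k \<le> W * d k powr \<beta> * Xa k"
      unfolding x_def using Wd by (intro mult_left_mono) auto
    also have "\<dots> = W * Ca * d k powr (- (\<alpha> * s))"
      by (simp add: Xa_def \<beta>_def algebra_simps flip: powr_add)
    also have "d k powr (- (\<alpha> * s)) = (2 powr (\<alpha> * s)) ^ k"
      by (simp add: d_def half_power_powr)
    finally show "x k \<le> 2 powr \<bar>(1 - \<alpha>) * s - 1\<bar> * (pi + 12 * pi * 4 powr p) * (2 powr (\<alpha> * s)) ^ k"
      by (simp add: W_def Ca_def)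
    have "x k \<le> W * d k powr \<beta> * Xb k"
      unfolding x_def using Wd by (intro mult_left_mono) auto
    also have "\<dots> = W * Cb * n powr (s / 2) * S k powr (s / 2) * (d k powr \<beta> * d k powr (1 - s / 2))"
      by (simp add: Xb_def powr_mult)
    also have "d k powr \<beta> * d k powr (1 - s / 2) = d k powr (s / 2 - \<alpha> * s)"
      by (simp add: \<beta>_def algebra_simps flip: powr_add)
    also have "d k powr (s / 2 - \<alpha> * s) = (2 powr (\<alpha> * s - s / 2)) ^ k"
      by (simp add: d_def half_power_powr)
    finally show "x k \<le> 2 powr \<bar>(1 - \<alpha>) * s - 1\<bar> * (pi * 9 powr (2 / p) * 2 powr (q / p) + 2 * pi)
        * n powr (s / 2) * (\<Sum>j\<le>k. 2 powr (real j * (2 - q) / p)) powr (s / 2) * (2 powr (\<alpha> * s - s / 2)) ^ k"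
      by (simp add: W_def Cb_def S_def)
  qed
qed

lemma two_powr_power_le:
  fixes n e :: real
  assumes "e \<ge> 0" "2 ^ m \<le> n"
  shows "(2 powr e) ^ m \<le> n powr e"
proof -
  have "(2 powr e) ^ m = (2 ^ m) powr e"
    by (simp add: powr_powr mult.commute flip: powr_realpow[of 2] powr_realpow[of "2 powr e"])
  also have "\<dots> \<le> n powr e"
    using assms by (intro powr_mono2) auto
  finally show ?thesis .
qed

lemma two_powr_minus_power_le:
  fixes n e :: real
  assumes "e \<ge> 0" "0 < n" "n \<le> 2 ^ m"
  shows "(2 powr (- e)) ^ m \<le> n powr (- e)"
proof -
  have "(2 powr (- e)) ^ m = (2 ^ m) powr (- e)"
    by (simp add: powr_powr mult.commute flip: powr_realpow[of 2] powr_realpow[of "2 powr (- e)"])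
  also have "\<dots> \<le> n powr (- e)"
    using assms by (intro powr_mono2') auto
  finally show ?thesis .
qed

section \<open>The two ranges of p, for Hardy norm at most 1\<close>

lemma besov_unit_large_p:
  assumes p: "p > 1" and \<alpha>: "0 < \<alpha>" "\<alpha> < 1 / 2" and s: "0 < s" "s < 2" and ps: "p \<ge> 2 * s / (2 - s)"
  obtains C :: real where "C > 0"
    "\<And>n f. n \<ge> 2 \<Longrightarrow> unit_hardy p f \<Longrightarrow> area_valent n f \<Longrightarrow>
      besov_seminorm_powr \<alpha> s f \<le> ennreal (C * n powr (\<alpha> * s) * ln n powr (s / 2))"
proof -
  have "s \<le> 2 * s / (2 - s)"
    using s by (simp add: field_simps)
  then have sp: "s \<le> p"
    using ps by simp
  define K1 where "K1 = 2 powr \<bar>(1 - \<alpha>) * s - 1\<bar> * (pi + 12 * pi * 4 powr p)"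
  define K2 where "K2 = 2 powr \<bar>(1 - \<alpha>) * s - 1\<bar> * (pi * 9 powr (2 / p) * 2 powr (2 / p) + 2 * pi)"
  define L where "L = 2 powr (\<alpha> * s)"
  \<comment> \<open>Decay rate of the area bound towards the boundary; positive because \<alpha> < 1
    / 2.\<close>
  define e where "e = s / 2 - \<alpha> * s"
  define r where "r = 2 powr (- e)"
  have e: "e > 0"
    using \<alpha> s by (simp add: e_def)
  have K: "K1 > 0" "K2 > 0"
    by (auto simp: K1_def K2_def intro!: mult_pos_pos add_pos_nonneg)
  have L: "L > 1"
    using \<alpha> s by (simp add: L_def)
  have r: "0 < r" "r < 1"
    using e by (auto simp: r_def powr_minus inverse_less_1_iff)
  define C where "C = (K1 * (L / (L - 1)) + 2 * K2 / (1 - r)\<^sup>2) * (2 / ln 2) powr (s / 2)"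
  show thesis
  proof (rule that[of C])
    show "C > 0"
      using K L r by (auto simp: C_def intro!: mult_pos_pos add_pos_pos)
  next
    fix n :: real and f
    assume n: "n \<ge> 2" and f: "unit_hardy p f" "area_valent n f"
    then have n0: "n > 0"
      by simp
    \<comment> \<open>Taken with q = 2, for which the admissibility condition q * s / (2 - s) \<le>
      p is exactly \<open>ps\<close>. All levels then count equally, and their sum is k + 1.\<close>
    obtain x :: "nat \<Rightarrow> real" where x: "besov_seminorm_powr \<alpha> s f \<le> (\<Sum>k. ennreal (x k))" "\<And>k. x k \<ge> 0"
      "\<And>k. x k \<le> K1 * L ^ k"
      "\<And>k. x k \<le> K2 * n powr (s / 2) * (\<Sum>j\<le>k. 2 powr (real j * (2 - 2) / p)) powr (s / 2) * (2 powr (\<alpha> * s - s / 2)) ^ k"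
      by (rule besov_dyadic_terms[OF f p s sp zero_le_numeral ps n0, of \<alpha>, folded K1_def K2_def L_def])
        (rule that)
    have x4: "x k \<le> K2 * n powr (s / 2) * real (Suc k) powr (s / 2) * r ^ k" for k
      using x(4)[of k] by (simp add: r_def e_def add.commute)
    \<comment> \<open>The head ends at \<open>m\<close>, where 2 ^ m \<le> n bounds its largest
      power of L; the tail starts at \<open>Suc m\<close>, where n < 2 ^ Suc m bounds its first
      power of r.\<close>
    obtain m where m: "2 ^ m \<le> n" "n < 2 ^ Suc m"
      using exists_dyadic_bracket[of n] n by auto
    have "m \<ge> 1"
      using m n by (cases m) auto
    \<comment> \<open>Everything in the tail that does not depend on the shifted index i. The final
      2 comes from i + 2 \<le> 2 * (i + 1), which matches the differentiated geometric
      series.\<close>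
    define A where "A = K2 * n powr (s / 2) * real (Suc m) powr (s / 2) * r ^ Suc m * 2"
    have "(\<lambda>i. of_nat (Suc i) * r ^ i) sums (1 / (1 - r)\<^sup>2)"
      using r by (intro geometric_deriv_sums) auto
    then have sums: "(\<lambda>i. A * (of_nat (Suc i) * r ^ i)) sums (A * (1 / (1 - r)\<^sup>2))"
      by (rule sums_mult)
    have tail: "x (i + Suc m) \<le> A * (of_nat (Suc i) * r ^ i)" for i
    proof -
      \<comment> \<open>Factors the number of levels into m + 1, which becomes the logarithm, and a
        part in i that the geometric decay absorbs.\<close>
      have "real (Suc (i + Suc m)) \<le> real (Suc m * (i + 2))"
        by (rule of_nat_mono) simp
      then have "real (Suc (i + Suc m)) powr (s / 2) \<le> real (Suc m * (i + 2)) powr (s / 2)"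
        by (intro powr_mono2) (use s in simp_all)
      also have "\<dots> = real (Suc m) powr (s / 2) * real (i + 2) powr (s / 2)"
        unfolding of_nat_mult by (rule powr_mult)
      also have "\<dots> \<le> real (Suc m) powr (s / 2) * (2 * real (Suc i))"
      proof (intro mult_left_mono)
        have "real (i + 2) powr (s / 2) \<le> real (i + 2) powr 1"
          using s by (intro powr_mono) auto
        then show "real (i + 2) powr (s / 2) \<le> 2 * real (Suc i)"
          by simp
      qed simp
      finally have le: "real (Suc (i + Suc m)) powr (s / 2) \<le> real (Suc m) powr (s / 2) * (2 * real (Suc i))" .
      have "x (i + Suc m) \<le> K2 * n powr (s / 2) * real (Suc (i + Suc m)) powr (s / 2) * r ^ (i + Suc m)"
        by (rule x4)
      also have "\<dots> \<le> K2 * n powr (s / 2) * (real (Suc m) powr (s / 2) * (2 * real (Suc i))) * r ^ (i + Suc m)"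
        using K r by (intro mult_right_mono mult_left_mono le) auto
      also have "\<dots> = A * (of_nat (Suc i) * r ^ i)"
        by (simp only: A_def power_add mult_ac)
      finally show ?thesis .
    qed
    have "besov_seminorm_powr \<alpha> s f \<le> ennreal ((\<Sum>k<Suc m. K1 * L ^ k) + A * (1 / (1 - r)\<^sup>2))"
      using x(1) suminf_ennreal_split_le[OF x(2) x(3) tail sums] by (rule order_trans)
    also have "\<dots> \<le> ennreal (C * n powr (\<alpha> * s) * ln n powr (s / 2))"
    proof (rule ennreal_leI)
      \<comment> \<open>The logarithmic factor, scaled to dominate (m + 1) powr (s / 2): n \<ge> 2
        gives m \<ge> 1, so m + 1 \<le> 2 * m \<le> 2 * ln n / ln 2. Hence also l \<ge> 1, and the
        head, which has no logarithm of its own, can be multiplied by l.\<close>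
      define l where "l = (2 / ln 2) powr (s / 2) * ln n powr (s / 2)"
      have l_eq: "l = (2 / ln 2 * ln n) powr (s / 2)"
        unfolding l_def by (rule powr_mult[symmetric])
      have "ln (2 ^ m) \<le> ln n"
        using m(1) n0 by (subst ln_le_cancel_iff) auto
      then have "real m * ln 2 \<le> ln n"
        by (simp add: ln_realpow)
      moreover have "1 * ln 2 \<le> real m * ln 2"
        using \<open>m \<ge> 1\<close> by (intro mult_right_mono) auto
      ultimately have "real (Suc m) * ln 2 \<le> 2 * ln n"
        unfolding of_nat_Suc distrib_right by linarith
      then have M: "real (Suc m) \<le> 2 / ln 2 * ln n"
        by (simp add: field_simps)
      then have Ml: "real (Suc m) powr (s / 2) \<le> l"
        unfolding l_eq using s by (intro powr_mono2) auto
      have "1 \<le> real (Suc m) powr (s / 2)"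
        using s by (intro ge_one_powr_ge_zero) auto
      with Ml have l1: "1 \<le> l"
        by linarith
      have Lm: "L ^ m \<le> n powr (\<alpha> * s)"
        unfolding L_def using \<alpha> s m by (intro two_powr_power_le) auto
      have "(\<Sum>k<Suc m. K1 * L ^ k) = K1 * (\<Sum>k\<le>m. L ^ k)"
        by (simp add: sum_distrib_left lessThan_Suc_atMost del: sum.lessThan_Suc)
      also have "\<dots> \<le> K1 * (L / (L - 1) * L ^ m)"
        using K L by (intro mult_left_mono sum_geometric_le) auto
      also have "\<dots> \<le> K1 * (L / (L - 1) * n powr (\<alpha> * s))"
        using K L Lm by (intro mult_left_mono) auto
      also have "\<dots> \<le> K1 * (L / (L - 1) * n powr (\<alpha> * s)) * l"
        using K L l1 mult_left_mono[OF l1, of "K1 * (L / (L - 1) * n powr (\<alpha> * s))"] by simp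
      finally have head: "(\<Sum>k<Suc m. K1 * L ^ k) \<le> K1 * (L / (L - 1)) * n powr (\<alpha> * s) * l"
        by (simp add: mult.assoc)
      have "A = 2 * K2 * n powr (s / 2) * (real (Suc m) powr (s / 2) * r ^ Suc m)"
        by (simp only: A_def mult_ac)
      also have "\<dots> \<le> 2 * K2 * n powr (s / 2) * (l * n powr (- e))"
        using K Ml l1 r e n m unfolding r_def
        by (intro mult_left_mono mult_mono two_powr_minus_power_le) auto
      also have "\<dots> = 2 * K2 * (n powr (s / 2) * n powr (- e)) * l"
        by (simp only: mult_ac)
      also have "n powr (s / 2) * n powr (- e) = n powr (\<alpha> * s)"
        by (simp add: e_def flip: powr_add)
      finally have "A * (1 / (1 - r)\<^sup>2) \<le> 2 * K2 * n powr (\<alpha> * s) * l * (1 / (1 - r)\<^sup>2)"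
        by (rule mult_right_mono) simp
      with head have "(\<Sum>k<Suc m. K1 * L ^ k) + A * (1 / (1 - r)\<^sup>2)
          \<le> K1 * (L / (L - 1)) * n powr (\<alpha> * s) * l + 2 * K2 * n powr (\<alpha> * s) * l * (1 / (1 - r)\<^sup>2)"
        by (rule add_mono)
      also have "\<dots> = (K1 * (L / (L - 1)) + 2 * K2 / (1 - r)\<^sup>2) * n powr (\<alpha> * s) * l"
        by (simp add: algebra_simps)
      also have "\<dots> = C * n powr (\<alpha> * s) * ln n powr (s / 2)"
        by (simp only: C_def l_def mult_ac)
      finally show "(\<Sum>k<Suc m. K1 * L ^ k) + A * (1 / (1 - r)\<^sup>2) \<le> C * n powr (\<alpha> * s) * ln n powr (s / 2)" .
    qed
    finally show "besov_seminorm_powr \<alpha> s f \<le> ennreal (C * n powr (\<alpha> * s) * ln n powr (s / 2))" .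
  qed
qed

text \<open>For n \<ge> 1 the tail dominates: at the cut it is of order n powr E, while the head is
  of order n powr (\<alpha> * s) and E \<ge> \<alpha> * s.\<close>

lemma besov_unit_small_p:
  assumes p: "p > 1" and \<alpha>: "0 < \<alpha>" and s: "0 < s" "s < 2"
    and ps: "p < 2 * s / (2 - s)" "s < p / (\<alpha> * p + 1)"
  obtains C :: real where "C > 0"
    "\<And>n f. n > 0 \<Longrightarrow> unit_hardy p f \<Longrightarrow> area_valent n f \<Longrightarrow>
      besov_seminorm_powr \<alpha> s f \<le> ennreal (C * n powr (\<alpha> * s + s / p + s / 2 - 1))"
proof -
  have "\<alpha> * p + 1 > 1"
    using \<alpha> p by simp
  then have s': "s * (\<alpha> * p + 1) < p"
    using ps(2) by (simp add: pos_less_divide_eq)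
  have sp: "s \<le> p"
  proof -
    have "s * 1 \<le> s * (\<alpha> * p + 1)"
      using s \<alpha> p by (intro mult_left_mono) auto
    with s' show ?thesis by simp
  qed
  \<comment> \<open>The largest q with q * s / (2 - s) \<le> p. The assumption p < 2 * s / (2 - s)
    says that q < 2, so the sum over the levels grows geometrically with ratio g > 1.\<close>
  define q where "q = p * (2 - s) / s"
  have q: "q \<ge> 0" "q * s / (2 - s) \<le> p"
    using p s by (auto simp: q_def)
  have q2: "q < 2"
    using ps(1) s by (simp add: q_def field_simps)
  define g where "g = 2 powr ((2 - q) / p)"
  have g: "g > 1"
    using q2 p by (simp add: g_def)
  define K1 where "K1 = 2 powr \<bar>(1 - \<alpha>) * s - 1\<bar> * (pi + 12 * pi * 4 powr p)"
  define K0 where "K0 = 2 powr \<bar>(1 - \<alpha>) * s - 1\<bar> * (pi * 9 powr (2 / p) * 2 powr (q / p) + 2 * pi)"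
  define K2 where "K2 = K0 * (g / (g - 1)) powr (s / 2)"
  define L where "L = 2 powr (\<alpha> * s)"
  \<comment> \<open>Decay rate of the area bound after the growth of the level sum has been
    deducted; its positivity is the assumption s < p / (\<alpha> * p + 1).\<close>
  define e where "e = 1 - \<alpha> * s - s / p"
  define E where "E = \<alpha> * s + s / p + s / 2 - 1"
  define r where "r = 2 powr (- e)"
  have e: "e > 0"
    using s' p by (simp add: e_def field_simps)
  have Ee: "E = s / 2 - e"
    by (simp add: E_def e_def)
  have "(2 - q) / p * (s / 2) = s / p - 1 + s / 2"
    using p s by (simp add: q_def field_simps)
  then have gs: "g powr (s / 2) = 2 powr (s / p - 1 + s / 2)"
    unfolding g_def powr_powr by simp
  have E_ge: "E \<ge> \<alpha> * s"
  proof -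
    have "0 \<le> (2 - q) / p * (s / 2)"
      using q2 p s by simp
    then show ?thesis
      using \<open>(2 - q) / p * (s / 2) = s / p - 1 + s / 2\<close> by (simp add: E_def)
  qed
  have K: "K1 > 0" "K0 > 0" "K2 > 0"
    using g by (auto simp: K1_def K0_def K2_def intro!: mult_pos_pos add_pos_nonneg)
  have L: "L > 1"
    using \<alpha> s by (simp add: L_def)
  have r: "0 < r" "r < 1"
    using e by (auto simp: r_def powr_minus inverse_less_1_iff)
  define C where "C = K1 * (L / (L - 1)) + K2 / (1 - r)"
  show thesis
  proof (rule that[of C])
    show "C > 0"
      using K L r by (auto simp: C_def intro!: mult_pos_pos add_pos_pos)
  next
    fix n :: real and f
    assume n: "n > 0" and f: "unit_hardy p f" "area_valent n f"
    obtain x :: "nat \<Rightarrow> real" where x: "besov_seminorm_powr \<alpha> s f \<le> (\<Sum>k. ennreal (x k))" "\<And>k. x k \<ge> 0"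
      "\<And>k. x k \<le> K1 * L ^ k"
      "\<And>k. x k \<le> K0 * n powr (s / 2) * (\<Sum>j\<le>k. 2 powr (real j * (2 - q) / p)) powr (s / 2) * (2 powr (\<alpha> * s - s / 2)) ^ k"
      using besov_dyadic_terms[OF f p s sp q n, of \<alpha>] unfolding K1_def K0_def L_def by metis
    have x4: "x k \<le> K2 * n powr (s / 2) * r ^ k" for k
    proof -
      have "(\<Sum>j\<le>k. 2 powr (real j * (2 - q) / p)) = (\<Sum>j\<le>k. g ^ j)"
        using powr_powr[of 2 "(2 - q) / p"] unfolding g_def
        by (intro sum.cong refl) (simp add: mult.commute flip: powr_realpow)
      also have "\<dots> \<le> g / (g - 1) * g ^ k"
        using g by (rule sum_geometric_le)
      finally have "(\<Sum>j\<le>k. 2 powr (real j * (2 - q) / p)) powr (s / 2) \<le> (g / (g - 1) * g ^ k) powr (s / 2)"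
        using s by (intro powr_mono2 sum_nonneg) auto
      also have "\<dots> = (g / (g - 1)) powr (s / 2) * (g powr (s / 2)) ^ k"
      proof -
        have "(g ^ k) powr (s / 2) = (g powr (s / 2)) ^ k"
          using g by (simp add: powr_powr mult.commute flip: powr_realpow)
        then show ?thesis
          by (simp only: powr_mult)
      qed
      finally have le: "(\<Sum>j\<le>k. 2 powr (real j * (2 - q) / p)) powr (s / 2) \<le> (g / (g - 1)) powr (s / 2) * (g powr (s / 2)) ^ k" .
      have "x k \<le> K0 * n powr (s / 2) * ((g / (g - 1)) powr (s / 2) * (g powr (s / 2)) ^ k) * (2 powr (\<alpha> * s - s / 2)) ^ k"
        using K by (intro order_trans[OF x(4)] mult_right_mono mult_left_mono le) auto
      also have "\<dots> = K2 * n powr (s / 2) * (g powr (s / 2) * 2 powr (\<alpha> * s - s / 2)) ^ k"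
        by (simp only: K2_def power_mult_distrib mult_ac)
      also have "g powr (s / 2) * 2 powr (\<alpha> * s - s / 2) = r"
        unfolding gs r_def e_def by (simp add: algebra_simps flip: powr_add)
      finally show ?thesis .
    qed
    \<comment> \<open>The cut \<open>M\<close> stays free: it is \<open>Suc m\<close> for n \<ge> 1
      and 0 for n < 1.\<close>
    have split: "besov_seminorm_powr \<alpha> s f
        \<le> ennreal ((\<Sum>k<M. K1 * L ^ k) + K2 * n powr (s / 2) * r ^ M * (1 / (1 - r)))" for M
    proof -
      have "(\<lambda>i. K2 * n powr (s / 2) * r ^ M * r ^ i) sums (K2 * n powr (s / 2) * r ^ M * (1 / (1 - r)))"
        using r by (intro sums_mult geometric_sums) auto
      moreover have "x (i + M) \<le> K2 * n powr (s / 2) * r ^ M * r ^ i" for i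
        using x4[of "i + M"] by (simp add: power_add mult_ac)
      ultimately show ?thesis
        using x(1) suminf_ennreal_split_le[OF x(2) x(3)] by (meson order_trans)
    qed
    show "besov_seminorm_powr \<alpha> s f \<le> ennreal (C * n powr (\<alpha> * s + s / p + s / 2 - 1))"
    proof (cases "n \<ge> 1")
      case True
      obtain m where m: "2 ^ m \<le> n" "n < 2 ^ Suc m"
        using exists_dyadic_bracket[OF True] by auto
      have Lm: "L ^ m \<le> n powr (\<alpha> * s)"
        unfolding L_def using \<alpha> s m by (intro two_powr_power_le) auto
      have "(\<Sum>k<Suc m. K1 * L ^ k) = K1 * (\<Sum>k\<le>m. L ^ k)"
        by (simp add: sum_distrib_left lessThan_Suc_atMost del: sum.lessThan_Suc)
      also have "\<dots> \<le> K1 * (L / (L - 1) * L ^ m)"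
        using K L by (intro mult_left_mono sum_geometric_le) auto
      also have "\<dots> \<le> K1 * (L / (L - 1) * n powr (\<alpha> * s))"
        using K L Lm by (intro mult_left_mono) auto
      also have "\<dots> \<le> K1 * (L / (L - 1) * n powr E)"
        using K L E_ge True by (intro mult_left_mono powr_mono) auto
      finally have head: "(\<Sum>k<Suc m. K1 * L ^ k) \<le> K1 * (L / (L - 1)) * n powr E"
        by (simp add: mult.assoc)
      have "K2 * n powr (s / 2) * r ^ Suc m * (1 / (1 - r)) \<le> K2 * n powr (s / 2) * n powr (- e) * (1 / (1 - r))"
        using K r e n m unfolding r_def
        by (intro mult_right_mono mult_left_mono two_powr_minus_power_le) auto
      also have "\<dots> = K2 / (1 - r) * n powr E"
        by (simp add: Ee mult.assoc flip: powr_add)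
      finally have "(\<Sum>k<Suc m. K1 * L ^ k) + K2 * n powr (s / 2) * r ^ Suc m * (1 / (1 - r)) \<le> C * n powr E"
        using head by (simp add: C_def distrib_right)
      then show ?thesis
        using split[of "Suc m"] unfolding E_def by (meson ennreal_leI order_trans)
    next
      case False
      \<comment> \<open>For n < 1 the area bound serves on every annulus and gives n powr (s / 2),
        which is at most n powr E because E = s / 2 - e is the smaller exponent.\<close>
      have "(\<Sum>k<0. K1 * L ^ k) + K2 * n powr (s / 2) * r ^ 0 * (1 / (1 - r)) = K2 / (1 - r) * n powr (s / 2)"
        by simp
      also have "\<dots> \<le> K2 / (1 - r) * n powr E"
        using K r False n e Ee by (intro mult_left_mono powr_mono') auto
      also have "\<dots> \<le> C * n powr E"
        using K L by (intro mult_right_mono) (auto simp: C_def)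
      finally show ?thesis
        using split[of 0] unfolding E_def by (meson ennreal_leI order_trans)
    qed
  qed
qed

section \<open>Reduction to Hardy norm at most 1\<close>

lemma hardy_space_circle_bound:
  assumes f: "f \<in> hardy_space p" and p: "p > 1" and r: "0 \<le> r" "r < 1"
  shows "(\<integral>\<^sup>+ t \<in> {0..2 * pi}. ennreal (norm (f (of_real r * cis t)) powr p) \<partial>lborel)
    \<le> ennreal (2 * pi * hardy_norm p f powr p)"
proof -
  have holo: "f holomorphic_on ball 0 1" and bdd: "bdd_above ((\<lambda>r. hardy_mean p r f) ` {0..<1})"
    using f by (auto simp: hardy_space_def)
  define I where "I = integral {0..2 * pi} (\<lambda>t. norm (f (of_real r * cis t)) powr p)"
  have cont: "continuous_on {0..2 * pi} (\<lambda>t. norm (f (of_real r * cis t)) powr p)"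
  proof -
    have "of_real r * cis t \<in> ball 0 1" for t
      using r by (simp add: norm_mult)
    then have "continuous_on {0..2 * pi} (\<lambda>t. f (of_real r * cis t))"
      by (intro continuous_on_compose2[OF holomorphic_on_imp_continuous_on[OF holo]] continuous_intros) auto
    then show ?thesis
      using p by (intro continuous_on_powr' continuous_intros) auto
  qed
  have I: "I \<ge> 0"
    unfolding I_def by (intro integral_nonneg integrable_continuous_interval cont) auto
  have "hardy_mean p r f \<le> hardy_norm p f"
    unfolding hardy_norm_def using bdd r by (intro cSUP_upper) auto
  then have "(1 / (2 * pi) * I) powr (1 / p) \<le> hardy_norm p f"
    by (simp add: hardy_mean_def I_def)
  then have "((1 / (2 * pi) * I) powr (1 / p)) powr p \<le> hardy_norm p f powr p"
    using p by (intro powr_mono2) auto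
  then have "I \<le> 2 * pi * hardy_norm p f powr p"
    using p I by (simp add: powr_powr field_simps)
  then show ?thesis
    using nn_integral_Icc_eq_integral[OF cont] by (simp add: I_def ennreal_leI)
qed

lemma hardy_norm_nonneg:
  assumes f: "f \<in> hardy_space p"
  shows "hardy_norm p f \<ge> 0"
proof -
  have "hardy_mean p 0 f \<le> hardy_norm p f"
    unfolding hardy_norm_def using f by (intro cSUP_upper) (auto simp: hardy_space_def)
  moreover have "hardy_mean p 0 f \<ge> 0"
    by (simp add: hardy_mean_def)
  ultimately show ?thesis
    by linarith
qed

lemma deriv_divide_const_ball:
  assumes "f holomorphic_on ball 0 1" "z \<in> ball 0 1"
  shows "deriv (\<lambda>w. f w / of_real N) z = deriv f z / of_real N"
  using assms by (intro deriv_cdivide_right) (auto simp: holomorphic_on_imp_differentiable_at)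

lemma unit_hardy_normalise:
  assumes f: "f \<in> hardy_space p" and p: "p > 1" and N: "N > 0" "N \<ge> hardy_norm p f"
  shows "unit_hardy p (\<lambda>z. f z / of_real N)"
  unfolding unit_hardy_def
proof (intro conjI allI impI)
  have holo: "f holomorphic_on ball 0 1"
    using f by (simp add: hardy_space_def)
  then show "(\<lambda>z. f z / of_real N) holomorphic_on ball 0 1"
    using N by (intro holomorphic_intros) auto
  fix r :: real
  assume r: "0 \<le> r" "r < 1"
  define h where "h t = ennreal (norm (f (of_real r * cis t)) powr p) * indicator {0..2 * pi} t" for t
  have "of_real r * cis t \<in> ball 0 1" for t
    using r by (simp add: norm_mult)
  then have "continuous_on {0..2 * pi} (\<lambda>t. norm (f (of_real r * cis t)) powr p)"
    using p
    by (intro continuous_on_powr' continuous_on_norm continuous_on_compose2[OF holomorphic_on_imp_continuous_on[OF holo]]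
         continuous_intros) auto
  then have "(\<lambda>t. indicator {0..2 * pi} t *\<^sub>R (norm (f (of_real r * cis t)) powr p)) \<in> borel_measurable borel"
    by (intro borel_measurable_continuous_on_indicator) auto
  then have "(\<lambda>t. ennreal (indicator {0..2 * pi} t *\<^sub>R (norm (f (of_real r * cis t)) powr p))) \<in> borel_measurable borel"
    by measurable
  moreover have "(\<lambda>t. ennreal (indicator {0..2 * pi} t *\<^sub>R (norm (f (of_real r * cis t)) powr p))) = h"
    by (auto simp: h_def fun_eq_iff indicator_def)
  ultimately have meas: "h \<in> borel_measurable borel"
    by (simp only:)
  have "(\<integral>\<^sup>+ t \<in> {0..2 * pi}. ennreal (norm (f (of_real r * cis t) / of_real N) powr p) \<partial>lborel)
      = (\<integral>\<^sup>+ t. ennreal (1 / N powr p) * h t \<partial>lborel)"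
    using N by (intro nn_integral_cong)
      (auto simp: h_def indicator_def norm_divide powr_divide simp flip: ennreal_mult)
  also have "\<dots> = ennreal (1 / N powr p) * (\<integral>\<^sup>+ t. h t \<partial>lborel)"
    using meas by (intro nn_integral_cmult) simp
  also have "\<dots> \<le> ennreal (1 / N powr p) * ennreal (2 * pi * hardy_norm p f powr p)"
    unfolding h_def using hardy_space_circle_bound[OF f p r] by (intro mult_left_mono) auto
  also have "\<dots> = ennreal (1 / N powr p * (2 * pi * hardy_norm p f powr p))"
    by (rule ennreal_mult[symmetric]) auto
  also have "\<dots> \<le> ennreal (1 / N powr p * (2 * pi * N powr p))"
    using N p hardy_norm_nonneg[OF f] by (intro ennreal_leI mult_left_mono powr_mono2) auto
  also have "1 / N powr p * (2 * pi * N powr p) = 2 * pi"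
    using N by simp
  finally show "(\<integral>\<^sup>+ t \<in> {0..2 * pi}. ennreal (norm (f (of_real r * cis t) / of_real N) powr p) \<partial>lborel)
      \<le> ennreal (2 * pi)" .
qed

text \<open>Division by N turns the level R into R * N, and the factor 1 / N^2 gained by |f'|^2
  cancels the N^2 in the area bound.\<close>

lemma area_valent_normalise:
  assumes f: "mean_valent n f (ball 0 1)" and N: "N > 0"
  shows "area_valent n (\<lambda>z. f z / of_real N)"
  unfolding area_valent_def
proof (intro allI impI)
  fix R :: real
  assume R: "R > 0"
  have holo: "f holomorphic_on ball 0 1"
    using f by (simp add: mean_valent_def)
  define W where "W = {z \<in> ball 0 1. norm (f z) < R * N}"
  have "open (ball 0 1 \<inter> f -` ball 0 (R * N))"
    using holo by (intro continuous_open_preimage holomorphic_on_imp_continuous_on) auto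
  moreover have "ball 0 1 \<inter> f -` ball 0 (R * N) = W"
    by (auto simp: W_def)
  ultimately have W: "W \<in> sets borel"
    by simp
  have "(\<lambda>z. ennreal (norm (deriv f z) powr 2) * indicator W z) \<in> borel_measurable borel"
    by (rule borel_measurable_norm_powr_holomorphic[OF holomorphic_deriv[OF holo] _ W]) (auto simp: W_def)
  then have meas: "(\<lambda>z. ennreal ((norm (deriv f z))\<^sup>2) * indicator W z) \<in> borel_measurable borel"
    by simp
  have "(\<integral>\<^sup>+ z \<in> {z \<in> ball 0 1. norm (f z / of_real N) < R}.
        ennreal ((norm (deriv (\<lambda>z. f z / of_real N) z))\<^sup>2) \<partial>lborel)
      = (\<integral>\<^sup>+ z. ennreal (1 / N\<^sup>2) * (ennreal ((norm (deriv f z))\<^sup>2) * indicator W z) \<partial>lborel)"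
  proof (intro nn_integral_cong)
    fix z
    show "ennreal ((norm (deriv (\<lambda>z. f z / of_real N) z))\<^sup>2) * indicator {z \<in> ball 0 1. norm (f z / of_real N) < R} z
        = ennreal (1 / N\<^sup>2) * (ennreal ((norm (deriv f z))\<^sup>2) * indicator W z)"
    proof (cases "z \<in> ball 0 1")
      case True
      have "(norm (deriv (\<lambda>z. f z / of_real N) z))\<^sup>2 = 1 / N\<^sup>2 * (norm (deriv f z))\<^sup>2"
        using deriv_divide_const_ball[OF holo True, of N] by (simp add: norm_divide power_divide)
      then show ?thesis
        using True N by (auto simp: W_def indicator_def norm_divide field_simps simp flip: ennreal_mult)
    qed (simp add: W_def)
  qed
  also have "\<dots> = ennreal (1 / N\<^sup>2) * (\<integral>\<^sup>+ z \<in> W. ennreal ((norm (deriv f z))\<^sup>2) \<partial>lborel)"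
    using meas by (intro nn_integral_cmult) simp
  also have "\<dots> \<le> ennreal (1 / N\<^sup>2) * ennreal (pi * n * (R * N)\<^sup>2)"
    unfolding W_def using f R N by (intro mult_left_mono mean_valent_area) auto
  also have "\<dots> = ennreal (1 / N\<^sup>2 * (pi * n * (R * N)\<^sup>2))"
    by (rule ennreal_mult'[symmetric]) simp
  also have "1 / N\<^sup>2 * (pi * n * (R * N)\<^sup>2) = pi * n * R\<^sup>2"
    using N by (simp add: power_mult_distrib)
  finally show "(\<integral>\<^sup>+ z \<in> {z \<in> ball 0 1. norm (f z / of_real N) < R}.
        ennreal ((norm (deriv (\<lambda>z. f z / of_real N) z))\<^sup>2) \<partial>lborel) \<le> ennreal (pi * n * R\<^sup>2)" .
qed

lemma besov_normalise_le:
  assumes holo: "f holomorphic_on ball 0 1" and N: "N > 0"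
    and B: "besov_seminorm_powr \<alpha> s (\<lambda>z. f z / of_real N) \<le> ennreal B"
  shows "besov_seminorm_powr \<alpha> s f \<le> ennreal (B * N powr s)"
proof -
  define g where "g = (\<lambda>z. f z / of_real N)"
  define u where "u = (\<lambda>z. ennreal (norm (deriv g z) powr s * (1 - (norm z)\<^sup>2) powr ((1 - \<alpha>) * s - 1)) * indicator (ball 0 1) z)"
  have g: "g holomorphic_on ball 0 1"
    unfolding g_def using holo N by (intro holomorphic_intros) auto
  have [measurable]: "(\<lambda>z. ennreal (norm (deriv g z) powr s) * indicator (ball 0 1) z) \<in> borel_measurable borel"
    using g by (intro borel_measurable_norm_powr_holomorphic[where G = "ball 0 1"] holomorphic_deriv) auto
  have "(\<lambda>z. (ennreal (norm (deriv g z) powr s) * indicator (ball 0 1) z)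
      * ennreal ((1 - (norm z)\<^sup>2) powr ((1 - \<alpha>) * s - 1))) \<in> borel_measurable borel"
    by measurable
  moreover have "(\<lambda>z. (ennreal (norm (deriv g z) powr s) * indicator (ball 0 1) z)
      * ennreal ((1 - (norm z)\<^sup>2) powr ((1 - \<alpha>) * s - 1))) = u"
    by (auto simp: u_def fun_eq_iff indicator_def ennreal_mult)
  ultimately have u: "u \<in> borel_measurable borel"
    by simp
  have "besov_seminorm_powr \<alpha> s f = (\<integral>\<^sup>+ z. ennreal (N powr s) * u z \<partial>lborel)"
    unfolding besov_seminorm_powr_def
  proof (intro nn_integral_cong)
    fix z
    show "ennreal (norm (deriv f z) powr s * (1 - (norm z)\<^sup>2) powr ((1 - \<alpha>) * s - 1)) * indicator (ball 0 1) z
        = ennreal (N powr s) * u z"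
    proof (cases "z \<in> ball 0 1")
      case True
      then have "norm (deriv f z) = N * norm (deriv g z)"
        using deriv_divide_const_ball[OF holo True, of N] N by (simp add: g_def norm_divide)
      then have "norm (deriv f z) powr s = N powr s * norm (deriv g z) powr s"
        by (simp add: powr_mult)
      then show ?thesis
        using True by (simp add: u_def ennreal_mult mult.assoc)
    qed (simp add: u_def)
  qed
  also have "\<dots> = ennreal (N powr s) * besov_seminorm_powr \<alpha> s g"
    using u by (subst nn_integral_cmult) (simp_all add: besov_seminorm_powr_def u_def)
  also have "\<dots> \<le> ennreal (N powr s) * ennreal B"
    using B unfolding g_def by (intro mult_left_mono) auto
  also have "\<dots> = ennreal (B * N powr s)"
    by (subst ennreal_mult'[symmetric]) (auto simp: mult.commute)
  finally show ?thesis .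
qed

text \<open>The norm is approached from above because it may vanish.\<close>

lemma besov_le_of_unit_bound:
  assumes f: "f \<in> hardy_space p" "mean_valent n f (ball 0 1)" and p: "p > 1" and s: "s > 0" and B: "B \<ge> 0"
    and unit: "\<And>g. unit_hardy p g \<Longrightarrow> area_valent n g \<Longrightarrow> besov_seminorm_powr \<alpha> s g \<le> ennreal B"
  shows "besov_seminorm_powr \<alpha> s f \<le> ennreal (B * hardy_norm p f powr s)"
proof -
  define N where "N = hardy_norm p f"
  have N: "N \<ge> 0"
    using hardy_norm_nonneg[OF f(1)] by (simp add: N_def)
  have holo: "f holomorphic_on ball 0 1"
    using f(1) by (simp add: hardy_space_def)
  have le: "besov_seminorm_powr \<alpha> s f \<le> ennreal (B * (N + e) powr s)" if e: "e > 0" for e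
  proof -
    have "besov_seminorm_powr \<alpha> s (\<lambda>z. f z / of_real (N + e)) \<le> ennreal B"
      using f p N e by (intro unit unit_hardy_normalise area_valent_normalise) (auto simp: N_def)
    then show ?thesis
      using N e by (intro besov_normalise_le[OF holo]) auto
  qed
  \<comment> \<open>As s > 0, the power is continuous from the right even at base 0, which covers N
    = 0.\<close>
  have "((\<lambda>e. B * (N + e) powr s) \<longlongrightarrow> B * (N + 0) powr s) (at_right 0)"
    using N s by (intro tendsto_intros tendsto_powr') (auto simp: eventually_at_filter)
  then have "((\<lambda>e. ennreal (B * (N + e) powr s)) \<longlongrightarrow> ennreal (B * (N + 0) powr s)) (at_right 0)"
    by (rule tendsto_ennrealI)
  moreover have "\<forall>\<^sub>F e in at_right 0. besov_seminorm_powr \<alpha> s f \<le> ennreal (B * (N + e) powr s)"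
    using le by (auto simp: eventually_at_filter)
  ultimately have "besov_seminorm_powr \<alpha> s f \<le> ennreal (B * (N + 0) powr s)"
    by (rule tendsto_lowerbound) simp
  then show ?thesis
    by (simp add: N_def)
qed

theorem theorem1p4:
  fixes p \<alpha> \<sigma> :: real
  assumes "p > 1" and "0 < \<alpha>" and "\<alpha> < 1 / 2" and "0 < \<sigma>" and "\<sigma> < 2"
  shows "(p \<ge> 2 * \<sigma> / (2 - \<sigma>) \<longrightarrow>
           (\<exists>C::real. C > 0 \<and> (\<forall>n::real. n \<ge> 2 \<longrightarrow>
              (\<forall>f \<in> hardy_space p. mean_valent n f (ball 0 1) \<longrightarrow>
                 besov_seminorm_powr \<alpha> \<sigma> f
                   \<le> ennreal (C * n powr (\<alpha> * \<sigma>) * (ln n) powr (\<sigma> / 2)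
                               * hardy_norm p f powr \<sigma>)))))
       \<and> (p < 2 * \<sigma> / (2 - \<sigma>) \<and> \<sigma> < p / (\<alpha> * p + 1) \<longrightarrow>
           (\<exists>C::real. C > 0 \<and> (\<forall>n::real. n > 0 \<longrightarrow>
              (\<forall>f \<in> hardy_space p. mean_valent n f (ball 0 1) \<longrightarrow>
                 besov_seminorm_powr \<alpha> \<sigma> f
                   \<le> ennreal (C * n powr (\<alpha> * \<sigma> + \<sigma> / p + \<sigma> / 2 - 1)
                               * hardy_norm p f powr \<sigma>)))))"
proof (intro conjI impI)
  assume ps: "p \<ge> 2 * \<sigma> / (2 - \<sigma>)"
  obtain C :: real where C: "C > 0"
    "\<And>n f. n \<ge> 2 \<Longrightarrow> unit_hardy p f \<Longrightarrow> area_valent n f \<Longrightarrow>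
      besov_seminorm_powr \<alpha> \<sigma> f \<le> ennreal (C * n powr (\<alpha> * \<sigma>) * ln n powr (\<sigma> / 2))"
    using besov_unit_large_p[OF assms ps] by blast
  have "besov_seminorm_powr \<alpha> \<sigma> f
      \<le> ennreal (C * n powr (\<alpha> * \<sigma>) * ln n powr (\<sigma> / 2) * hardy_norm p f powr \<sigma>)"
    if "n \<ge> 2" "f \<in> hardy_space p" "mean_valent n f (ball 0 1)" for n f
    using that C assms by (intro besov_le_of_unit_bound) auto
  then show "\<exists>C::real. C > 0 \<and> (\<forall>n::real. n \<ge> 2 \<longrightarrow>
              (\<forall>f \<in> hardy_space p. mean_valent n f (ball 0 1) \<longrightarrow>
                 besov_seminorm_powr \<alpha> \<sigma> f
                   \<le> ennreal (C * n powr (\<alpha> * \<sigma>) * (ln n) powr (\<sigma> / 2)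
                               * hardy_norm p f powr \<sigma>)))"
    using C(1) by blast
next
  assume ps: "p < 2 * \<sigma> / (2 - \<sigma>) \<and> \<sigma> < p / (\<alpha> * p + 1)"
  obtain C :: real where C: "C > 0"
    "\<And>n f. n > 0 \<Longrightarrow> unit_hardy p f \<Longrightarrow> area_valent n f \<Longrightarrow>
      besov_seminorm_powr \<alpha> \<sigma> f \<le> ennreal (C * n powr (\<alpha> * \<sigma> + \<sigma> / p + \<sigma> / 2 - 1))"
    using besov_unit_small_p[OF assms(1,2,4,5)] ps by blast
  have "besov_seminorm_powr \<alpha> \<sigma> f
      \<le> ennreal (C * n powr (\<alpha> * \<sigma> + \<sigma> / p + \<sigma> / 2 - 1) * hardy_norm p f powr \<sigma>)"
    if "n > 0" "f \<in> hardy_space p" "mean_valent n f (ball 0 1)" for n f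
    using that C assms by (intro besov_le_of_unit_bound) auto
  then show "\<exists>C::real. C > 0 \<and> (\<forall>n::real. n > 0 \<longrightarrow>
              (\<forall>f \<in> hardy_space p. mean_valent n f (ball 0 1) \<longrightarrow>
                 besov_seminorm_powr \<alpha> \<sigma> f
                   \<le> ennreal (C * n powr (\<alpha> * \<sigma> + \<sigma> / p + \<sigma> / 2 - 1)
                               * hardy_norm p f powr \<sigma>)))"
    using C(1) by blast
qed

end
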